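(* Let $n\ge7$, let $f_0\in l_2(\nu)$, let $\{\mathcal{P}_m\}_{m\in\mathbb{N}}$ be a sequence of models in $l_2(\nu)$, and for each $m$ let $D_m\ge1$ satisfy $D_m\ge\mathrm{pdim}(F(\underline X^n;\mathcal{P}_m))$ almost surely. Let the errors $\epsilon_i$ be i.i.d. $\mathcal{N}(0,\sigma^2)$. Let $L_m$ be a sequence of numbers such that $\sum_{m\in\mathbb{N}}\exp(-L_mD_m)=\Sigma<\infty$. Let the penalty function be $$\mathrm{pen}(m):=\frac{\mathfrak{c}_{p,1}\sigma^2D_m}{n}\big(\mathfrak{c}_{p,2}\,\kappa\log n+L_m\big),$$ where $\mathfrak{c}_{p,1},\mathfrak{c}_{p,2}$ are absolute constants, which can be taken as $\mathfrak{c}_{p,1}=16$ and $\mathfrak{c}_{p,2}=9\cdot2^{15}$, and let $$\hat m^{ms}:=\arg\min_{m\in\mathbb{N}}\big(\gamma_n(\hat f_m)+\mathrm{pen}(m)\big),\qquad\gamma_n(g):=\frac1n\sum_{i=1}^ng(X_i)^2-\frac2n\sum_{i=1}^nY_ig(X_i).$$ Then $$\mathbb{E}\big[l_{\underline X^n}^2(\hat f_{\hat m^{ms}},f_0)\big]\le\inf_{m\in\mathbb{N}}\Big(3\inf_{g\in\mathcal{P}_m}l_\nu^2(f_0,g)+\mathfrak{h}_{\kappa,\Sigma}\frac{\sigma^2L_mD_m\log n}{n}\Big),$$ where $\mathfrak{h}_{\kappa,\Sigma}$ is a constant depending only on $\kappa$ and $\Sigma$; explicitly one can take $\mathfrak{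h}_{\kappa,\Sigma}=3.02\times10^8+9\cdot2^{20}\kappa+32\Sigma$.
   Context: Regression model with random design: $X_1,\dots,X_n$ i.i.d. from a probability measure $\nu$ on $\Omega\subset\mathbb{R}^d$, $Y_i=f_0(X_i)+\epsilon_i$, errors independent of the $X_i$'s. $l_2(\nu)$ is the set of $\nu$-square-integrable functions. $l_\nu^2(f,g):=\int(f-g)^2\,d\nu$, $l_{\underline X^n}^2(f,g):=\frac1n\sum_{i=1}^n(f(X_i)-g(X_i))^2$. For each $m$, $\hat f_m\in\arg\min_{f\in\mathcal{P}_m}\frac1n\sum_{i=1}^n(Y_i-f(X_i))^2$, assumed to exist; the minimizer $\hat m^{ms}$ is also assumed to exist. $F(\underline X^n;\mathcal{P}_m):=\{(g(X_1),\dots,g(X_n)):g\in\mathcal{P}_m\}\subset\mathbb{R}^n$. A set $V\subset\mathbb{R}^n$ has pseudo-dimension $\mathrm{pdim}(V)$ at most $t$ if for every set $I\subset\{1,\dots,n\}$ of $t+1$ distinct indices and every $x\in\mathbb{R}^I$ there is $J\subset I$ such that no $v\in V$ satisfies both $v_i>x_i$ for all $i\in J$ and $v_i<x_i$ for all $i\in I\setminus J$; $\mathrm{pdim}(V)$ is the smallest such $t$. $\kappa\ge1$ is an absolute constant (it exists, by Mendelson and Vershynin) such that for all $n$, every $V\subset\mathbb{R}^n$ with $\sup_{v\in V}\|v\|_\infty\le B$ and pseudo-dimension at most $t$, and every $\epsilon>0$, the minimal number of Euclidean $\epsilon$-balls covering $V$ is at most $(4+2B\sqrt n/\epsilon)^{\kappa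 t}$.
   Formalization: The weights are assumed to satisfy L_m ≥ 1 for all m (with L_0 = 0 the claimed bound can be 0 while the risk is σ²/n > 0); the loss of the selected estimator is assumed to be a measurable function of the data, and σ > 0. *)

theory Defs
  imports "HOL-Probability.Probability"
begin

text \<open>
  Vectors of \<open>\<real>\<^sup>n\<close> are functions in \<open>{..<n} \<rightarrow>\<^sub>E UNIV\<close>; the index set \<open>{1, \<dots>, n}\<close> of the paper becomes
  \<open>{..<n}\<close>.  A data set is a pair \<open>(x, y)\<close> of a vector of design points and a vector of responses.
\<close>

definition square_integrable :: "'a measure \<Rightarrow> ('a \<Rightarrow> real) set" where
  "square_integrable \<nu> = {f \<in> borel_measurable \<nu>. integrable \<nu> (\<lambda>x. (f x)\<^sup>2)}"

definition sq_dist :: "'a measure \<Rightarrow> ('a \<Rightarrow> real) \<Rightarrow> ('a \<Rightarrow> real) \<Rightarrow> real" where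
  "sq_dist \<nu> f g = (\<integral>x. (f x - g x)\<^sup>2 \<partial>\<nu>)"

definition emp_sq_dist :: "nat \<Rightarrow> (nat \<Rightarrow> 'a) \<Rightarrow> ('a \<Rightarrow> real) \<Rightarrow> ('a \<Rightarrow> real) \<Rightarrow> real" where
  "emp_sq_dist n x f g = (1 / real n) * (\<Sum>i<n. (f (x i) - g (x i))\<^sup>2)"

definition emp_risk :: "nat \<Rightarrow> (nat \<Rightarrow> 'a) \<times> (nat \<Rightarrow> real) \<Rightarrow> ('a \<Rightarrow> real) \<Rightarrow> real" where
  "emp_risk n d f = (1 / real n) * (\<Sum>i<n. (snd d i - f (fst d i))\<^sup>2)"

definition contrast :: "nat \<Rightarrow> (nat \<Rightarrow> 'a) \<times> (nat \<Rightarrow> real) \<Rightarrow> ('a \<Rightarrow> real) \<Rightarrow> real" where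
  "contrast n d g = (1 / real n) * (\<Sum>i<n. (g (fst d i))\<^sup>2)
     - (2 / real n) * (\<Sum>i<n. snd d i * g (fst d i))"

definition data_space :: "nat \<Rightarrow> 'a measure \<Rightarrow> ((nat \<Rightarrow> 'a) \<times> (nat \<Rightarrow> real)) measure" where
  "data_space n \<nu> = (\<Pi>\<^sub>M i\<in>{..<n}. \<nu>) \<Otimes>\<^sub>M (\<Pi>\<^sub>M i\<in>{..<n}. borel)"

definition sample :: "nat \<Rightarrow> (nat \<Rightarrow> 'w \<Rightarrow> 'a) \<Rightarrow> 'w \<Rightarrow> nat \<Rightarrow> 'a" where
  "sample n Z \<omega> = (\<lambda>i\<in>{..<n}. Z i \<omega>)"

definition data :: "nat \<Rightarrow> (nat \<Rightarrow> 'w \<Rightarrow> 'a) \<Rightarrow> (nat \<Rightarrow> 'w \<Rightarrow> real) \<Rightarrow> 'w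
    \<Rightarrow> (nat \<Rightarrow> 'a) \<times> (nat \<Rightarrow> real)" where
  "data n X Y \<omega> = (sample n X \<omega>, sample n Y \<omega>)"

definition traces :: "nat \<Rightarrow> (nat \<Rightarrow> 'a) \<Rightarrow> ('a \<Rightarrow> real) set \<Rightarrow> (nat \<Rightarrow> real) set" where
  "traces n x P = (\<lambda>g. \<lambda>i\<in>{..<n}. g (x i)) ` P"

definition pdim_at_most :: "nat \<Rightarrow> (nat \<Rightarrow> real) set \<Rightarrow> nat \<Rightarrow> bool" where
  "pdim_at_most n V t \<longleftrightarrow>
     (\<forall>I\<subseteq>{..<n}. card I = t + 1 \<longrightarrow>
       (\<forall>x. \<exists>J\<subseteq>I. \<not> (\<exists>v\<in>V. (\<forall>i\<in>J. v i > x i) \<and> (\<forall>i\<in>I - J. v i < x i))))"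

text \<open>The minimum exists: \<open>t = n\<close> always qualifies, there being no \<open>n + 1\<close> distinct indices.\<close>

definition pdim :: "nat \<Rightarrow> (nat \<Rightarrow> real) set \<Rightarrow> nat" where
  "pdim n V = (LEAST t. pdim_at_most n V t)"

definition covering_number :: "nat \<Rightarrow> (nat \<Rightarrow> real) set \<Rightarrow> real \<Rightarrow> enat" where
  "covering_number n V e =
     (INF C \<in> {C. finite C \<and> C \<subseteq> ({..<n} \<rightarrow>\<^sub>E UNIV) \<and>
                  (\<forall>v\<in>V. \<exists>c\<in>C. sqrt (\<Sum>i<n. (v i - c i)\<^sup>2) \<le> e)}. enat (card C))"

text \<open>
  The property defining the absolute constant \<open>\<kappa>\<close>.  Such a constant exists by a theorem of
  Mendelson and Vershynin.
\<close>

definition entropy_constant :: "real \<Rightarrow> bool" where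
  "entropy_constant \<kappa> \<longleftrightarrow>
     1 \<le> \<kappa> \<and>
     (\<forall>n V B t e. V \<subseteq> ({..<n} \<rightarrow>\<^sub>E UNIV) \<longrightarrow> (\<forall>v\<in>V. \<forall>i<n. \<bar>v i\<bar> \<le> B) \<longrightarrow>
        pdim_at_most n V t \<longrightarrow> 0 < e \<longrightarrow>
        ereal_of_enat (covering_number n V e)
          \<le> ereal ((4 + 2 * B * sqrt (real n) / e) powr (\<kappa> * real t)))"

definition penalty :: "real \<Rightarrow> real \<Rightarrow> nat \<Rightarrow> (nat \<Rightarrow> real) \<Rightarrow> (nat \<Rightarrow> real) \<Rightarrow> nat \<Rightarrow> real" where
  "penalty \<kappa> \<sigma> n L D m =
     16 * \<sigma>\<^sup>2 * D m / real n * (9 * 2 ^ 15 * \<kappa> * ln (real n) + L m)"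

definition risk_constant :: "real \<Rightarrow> real \<Rightarrow> real" where
  "risk_constant \<kappa> S = 3.02 * 10 ^ 8 + 9 * 2 ^ 20 * \<kappa> + 32 * S"

end

theory Submission
  imports Defs
begin

text \<open>
  The least squares and the model selection inequalities bound the loss by three times the
  approximation error of a fixed \<open>g\<close>, twice its penalty, and twice the excess of
  \<open>(2 \<langle>\<epsilon>, u\<rangle> - \<parallel>u\<parallel>\<^sup>2 / 4) / n\<close> over the penalty of the selected model, where \<open>u\<close> is the trace of
  \<open>fhat m - g\<close> on the design.  As the penalty carries a factor \<open>log n\<close>, no chaining is needed to bound
  this excess at a fixed design: only \<open>\<parallel>u\<parallel> \<le> 8 \<parallel>\<epsilon>\<parallel>\<close> matters, the event \<open>\<parallel>\<epsilon>\<parallel> > \<sigma> n\<close> is handled by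
  fourth moments, and on the rest a single net of mesh \<open>\<sigma> / \<surd>n\<close> in the ball of radius \<open>8 \<sigma> n\<close> has
  at most \<open>n\<close> to the power \<open>5 \<kappa> D m\<close> points \<open>c\<close>.  Each normal variable \<open>Z = \<langle>\<epsilon>, c\<rangle> / \<parallel>c\<parallel>\<close> satisfies
  \<open>E (4 Z\<^sup>2 - 16 \<sigma>\<^sup>2 y)\<^sub>+ \<le> 16 \<sigma>\<^sup>2 exp (- y)\<close>, and summing over all nets and models gives \<open>16 \<sigma>\<^sup>2 S\<close>.
\<close>

section \<open>Pseudo-dimension and Euclidean nets\<close>

lemma pdim_at_most_pdim: "pdim_at_most n V (pdim n V)"
proof -
  have "card I \<noteq> n + 1" if "I \<subseteq> {..<n}" for I
    using card_mono[OF _ that] by simp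
  then have "pdim_at_most n V n"
    unfolding pdim_at_most_def by blast
  then show ?thesis
    unfolding pdim_def by (rule LeastI)
qed

text \<open>Moving the thresholds from \<open>x\<close> to \<open>x + w\<close> turns a pattern
  realized by \<open>U\<close> at \<open>x\<close> into one realized by \<open>V\<close> at
  \<open>x + w\<close>. As \<open>U\<close> may be any part of the translate, the bound survives
  both centring at a fixed trace and restriction to a ball.\<close>

lemma pdim_at_most_translate:
  assumes V: "pdim_at_most n V t"
    and U: "\<And>u. u \<in> U \<Longrightarrow> \<exists>v\<in>V. \<forall>i<n. u i = v i - w i"
  shows "pdim_at_most n U t"
  unfolding pdim_at_most_def
proof (intro allI impI)
  fix I x assume I: "I \<subseteq> {..<n}" "card I = t + 1"
  then obtain J where J: "J \<subseteq> I"
    "\<not> (\<exists>v\<in>V. (\<forall>i\<in>J. v i > x i + w i) \<and> (\<forall>i\<in>I - J. v i < x i + w i))"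
    using V[unfolded pdim_at_most_def, rule_format, of I "\<lambda>i. x i + w i"] by blast
  have "\<not> (\<exists>u\<in>U. (\<forall>i\<in>J. u i > x i) \<and> (\<forall>i\<in>I - J. u i < x i))"
  proof
    assume "\<exists>u\<in>U. (\<forall>i\<in>J. u i > x i) \<and> (\<forall>i\<in>I - J. u i < x i)"
    then obtain u where u: "u \<in> U" "\<forall>i\<in>J. u i > x i" "\<forall>i\<in>I - J. u i < x i" by blast
    obtain v where v: "v \<in> V" "\<forall>i<n. u i = v i - w i" using U[OF u(1)] by blast
    have "\<forall>i\<in>J. v i > x i + w i"
    proof
      fix i assume "i \<in> J"
      then have "i < n" "u i > x i" using J(1) I(1) u(2) by auto
      then show "v i > x i + w i" using v(2) by auto
    qed
    moreover have "\<forall>i\<in>I - J. v i < x i + w i"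
    proof
      fix i assume "i \<in> I - J"
      then have "i < n" "u i < x i" using I(1) u(3) by auto
      then show "v i < x i + w i" using v(2) by auto
    qed
    ultimately show False using J(2) v(1) by blast
  qed
  then show "\<exists>J\<subseteq>I. \<not> (\<exists>v\<in>U. (\<forall>i\<in>J. v i > x i) \<and> (\<forall>i\<in>I - J. v i < x i))"
    using J(1) by blast
qed

text \<open>Turns the bound on the covering number into an actual net. An infimum over no covers
  would be \<open>\<infinity>\<close>, against the real bound, and the well-order of
  \<open>enat\<close> makes the infimum over a nonempty family attained.\<close>

lemma entropy_net:
  assumes \<kappa>: "entropy_constant \<kappa>"
    and V: "V \<subseteq> ({..<n} \<rightarrow>\<^sub>E UNIV)" "\<And>v i. v \<in> V \<Longrightarrow> i < n \<Longrightarrow> \<bar>v i\<bar> \<le> B"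
    and t: "pdim_at_most n V t" and e: "0 < e"
  obtains C where "finite C" "\<And>v. v \<in> V \<Longrightarrow> \<exists>c\<in>C. L2_set (\<lambda>i. v i - c i) {..<n} \<le> e"
    "real (card C) \<le> (4 + 2 * B * sqrt (real n) / e) powr (\<kappa> * real t)"
proof -
  define F where "F = {C. finite C \<and> C \<subseteq> ({..<n} \<rightarrow>\<^sub>E UNIV) \<and>
                  (\<forall>v\<in>V. \<exists>c\<in>C. sqrt (\<Sum>i<n. (v i - c i)\<^sup>2) \<le> e)}"
  have bound: "ereal_of_enat (INF C\<in>F. enat (card C))
      \<le> ereal ((4 + 2 * B * sqrt (real n) / e) powr (\<kappa> * real t))"
    using \<kappa> V t e unfolding entropy_constant_def covering_number_def F_def by blast
  have "\<exists>C0. C0 \<in> F"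
  proof (rule ccontr)
    assume "\<nexists>C0. C0 \<in> F"
    then have "F = {}" by blast
    then have "(INF C\<in>F. enat (card C)) = \<infinity>" by (simp add: top_enat_def)
    with bound show False by simp
  qed
  then obtain C0 where "C0 \<in> F" ..
  then have "(INF C\<in>F. enat (card C)) \<in> (\<lambda>C. enat (card C)) ` F"
    by (intro wellorder_InfI[of "enat (card C0)"]) auto
  then obtain C where "C \<in> F" "(INF C\<in>F. enat (card C)) = enat (card C)" by blast
  then show thesis
    using bound by (intro that[of C]) (auto simp: F_def L2_set_def)
qed

section \<open>Gaussian excess in a fixed direction\<close>

text \<open>As \<open>ennreal\<close> cuts off negative values, this concerns the positive part of
  the excess. An exponential bound on the excess, multiplied by the density of variance
  \<open>\<sigma>\<^sup>2\<close>, is a multiple of the density of variance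
  \<open>2 * \<sigma>\<^sup>2\<close>, whose integral is 1; no tail probabilities have to be
  integrated.\<close>

lemma nn_integral_normal_sq_excess:
  fixes Z :: "'w \<Rightarrow> real"
  assumes Z: "distributed M lborel Z (\<lambda>z. ennreal (normal_density 0 \<sigma> z))" and \<sigma>: "\<sigma> > 0"
  shows "(\<integral>\<^sup>+\<omega>. ennreal (4 * (Z \<omega>)\<^sup>2 - 16 * \<sigma>\<^sup>2 * y) \<partial>M) \<le> ennreal (16 * \<sigma>\<^sup>2 * exp (- y))"
proof -
  have excess: "normal_density 0 \<sigma> z * (4 * z\<^sup>2 - 16 * \<sigma>\<^sup>2 * y)
      \<le> 16 * \<sigma>\<^sup>2 * exp (- y) * normal_density 0 (sqrt 2 * \<sigma>) z" for z
  proof -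
    \<comment> \<open>The excess equals \<open>16 * \<sigma>\<^sup>2 * t\<close>, and the factor
      \<open>exp t\<close> halves the rate in the Gaussian exponent and leaves
      \<open>exp (- y)\<close> outside.\<close>
    define t where "t = z\<^sup>2 / (4 * \<sigma>\<^sup>2) - y"
    \<comment> \<open>The right side is \<open>exp t\<close>, split so that
      \<open>1 + s \<le> exp s\<close> can be used at \<open>s = 1\<close> and at
      \<open>s = t - 1\<close>.\<close>
    have "2 * t \<le> exp 1 * exp (t - 1)"
    proof (cases "t \<ge> 0")
      case True
      have "exp 1 \<ge> (2::real)" using exp_ge_add_one_self[of 1] by simp
      moreover have "exp (t - 1) \<ge> t" using exp_ge_add_one_self[of "t - 1"] by simp
      ultimately show ?thesis using True by (intro mult_mono) auto
    next
      case False
      have "0 \<le> exp 1 * exp (t - 1)" by simp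
      with False show ?thesis by linarith
    qed
    then have t: "2 * t \<le> exp t" by (simp flip: exp_add)
    have "4 * z\<^sup>2 - 16 * \<sigma>\<^sup>2 * y = 8 * \<sigma>\<^sup>2 * (2 * t)"
      using \<sigma> by (simp add: t_def field_simps)
    also have "\<dots> \<le> 8 * \<sigma>\<^sup>2 * exp t"
      using t by (intro mult_left_mono) auto
    finally have "normal_density 0 \<sigma> z * (4 * z\<^sup>2 - 16 * \<sigma>\<^sup>2 * y)
        \<le> normal_density 0 \<sigma> z * (8 * \<sigma>\<^sup>2 * exp t)"
      by (intro mult_left_mono) auto
    also have "\<dots> = 8 * \<sigma>\<^sup>2 * exp (- y) * (sqrt 2 * normal_density 0 (sqrt 2 * \<sigma>) z)"
    proof -
      have "exp (- z\<^sup>2 / (2 * \<sigma>\<^sup>2)) * exp t = exp (- y) * exp (- z\<^sup>2 / (4 * \<sigma>\<^sup>2))"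
        using \<sigma> by (simp add: t_def field_simps flip: exp_add)
      moreover have "sqrt (2 * pi * (sqrt 2 * \<sigma>)\<^sup>2) = sqrt 2 * sqrt (2 * pi * \<sigma>\<^sup>2)"
        by (simp add: real_sqrt_mult power_mult_distrib)
      ultimately show ?thesis
        using \<sigma> by (simp add: normal_density_def power_mult_distrib field_simps)
    qed
    \<comment> \<open>Rounding \<open>sqrt 2\<close> up to 2 produces the constant 16.\<close>
    also have "\<dots> \<le> 8 * \<sigma>\<^sup>2 * exp (- y) * (2 * normal_density 0 (sqrt 2 * \<sigma>) z)"
      by (intro mult_left_mono mult_right_mono) (auto intro: real_le_lsqrt)
    finally show ?thesis by simp
  qed
  have "(\<integral>\<^sup>+\<omega>. ennreal (4 * (Z \<omega>)\<^sup>2 - 16 * \<sigma>\<^sup>2 * y) \<partial>M)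
      = (\<integral>\<^sup>+z. ennreal (normal_density 0 \<sigma> z) * ennreal (4 * z\<^sup>2 - 16 * \<sigma>\<^sup>2 * y) \<partial>lborel)"
    by (rule distributed_nn_integral[OF Z, symmetric]) simp
  also have "\<dots> \<le> (\<integral>\<^sup>+z. ennreal (16 * \<sigma>\<^sup>2 * exp (- y)) * ennreal (normal_density 0 (sqrt 2 * \<sigma>) z) \<partial>lborel)"
    using excess by (intro nn_integral_mono) (simp add: ennreal_leI flip: ennreal_mult' ennreal_mult'')
  also have "\<dots> = ennreal (16 * \<sigma>\<^sup>2 * exp (- y)) * (\<integral>\<^sup>+z. ennreal (normal_density 0 (sqrt 2 * \<sigma>) z) \<partial>lborel)"
    by (rule nn_integral_cmult) simp
  also have "(\<integral>\<^sup>+z. ennreal (normal_density 0 (sqrt 2 * \<sigma>) z) \<partial>lborel) = 1"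
    using \<sigma> by (subst nn_integral_eq_integral) auto
  finally show ?thesis by simp
qed

text \<open>After division by the length of \<open>c\<close>, the variances of the independent
  summands add up to \<open>\<sigma>\<^sup>2\<close>, so the law of the quotient is the same in
  every direction.\<close>

lemma (in prob_space) nn_integral_normal_direction_sq_excess:
  fixes \<epsilon> :: "nat \<Rightarrow> 'a \<Rightarrow> real"
  assumes indep: "indep_vars (\<lambda>_. borel) \<epsilon> {..<n}" and \<sigma>: "\<sigma> > 0" and y: "y \<ge> 0"
    and normal: "\<And>i. i < n \<Longrightarrow> distributed M lborel (\<epsilon> i) (\<lambda>z. ennreal (normal_density 0 \<sigma> z))"
  shows "(\<integral>\<^sup>+\<omega>. ennreal (4 * ((\<Sum>i<n. c i * \<epsilon> i \<omega>) / L2_set c {..<n})\<^sup>2 - 16 * \<sigma>\<^sup>2 * y) \<partial>M)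
      \<le> ennreal (16 * \<sigma>\<^sup>2 * exp (- y))"
proof (cases "\<exists>i<n. c i \<noteq> 0")
  \<comment> \<open>Here \<open>c\<close> vanishes on \<open>{..<n}\<close>: the quotient is
    \<open>0 / 0 = 0\<close>, and \<open>y \<ge> 0\<close> makes the integrand zero.\<close>
  case False
  then have "(\<Sum>i<n. c i * \<epsilon> i \<omega>) = 0" for \<omega> by (intro sum.neutral) auto
  then show ?thesis using y by (simp add: ennreal_neg)
next
  case True
  define l where "l = L2_set c {..<n}"
  \<comment> \<open>Zero coefficients are discarded, since a variable scaled by 0 has no
    density.\<close>
  define I where "I = {i. i < n \<and> c i \<noteq> 0}"
  have I: "finite I" "I \<noteq> {}" "I \<subseteq> {..<n}" using True by (auto simp: I_def)
  have l2: "l\<^sup>2 = (\<Sum>i\<in>I. (c i)\<^sup>2)"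
    unfolding l_def L2_set_def by (simp add: sum_nonneg I_def) (rule sum.mono_neutral_right; auto)
  also have "\<dots> > 0" using I by (intro sum_pos) (auto simp: I_def)
  finally have "l > 0" by (simp add: l_def less_le)
  have "indep_vars (\<lambda>_. borel) (\<lambda>i. (\<lambda>z. c i / l * z) \<circ> \<epsilon> i) I"
    by (intro indep_vars_compose[OF indep_vars_subset[OF indep I(3)]]) auto
  moreover have "distributed M lborel (\<lambda>\<omega>. c i / l * \<epsilon> i \<omega>)
      (\<lambda>z. ennreal (normal_density 0 (\<bar>c i / l\<bar> * \<sigma>) z))" if "i \<in> I" for i
    using normal_density_affine[OF normal[of i] \<sigma>, of "c i / l" 0] that \<open>l > 0\<close> by (simp add: I_def)
  ultimately have "distributed M lborel (\<lambda>\<omega>. \<Sum>i\<in>I. c i / l * \<epsilon> i \<omega>)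
      (normal_density (\<Sum>i\<in>I. 0) (sqrt (\<Sum>i\<in>I. (\<bar>c i / l\<bar> * \<sigma>)\<^sup>2)))"
    using I \<open>l > 0\<close> \<sigma> by (intro sum_indep_normal) (auto simp: I_def comp_def)
  moreover have "sqrt (\<Sum>i\<in>I. (\<bar>c i / l\<bar> * \<sigma>)\<^sup>2) = \<sigma>"
    using \<sigma> \<open>l > 0\<close>
    by (simp add: power_mult_distrib power_divide flip: sum_distrib_right sum_divide_distrib l2)
  moreover have "(\<Sum>i\<in>I. c i / l * \<epsilon> i \<omega>) = (\<Sum>i<n. c i * \<epsilon> i \<omega>) / l" for \<omega>
    using I(3) by (subst sum_divide_distrib, intro sum.mono_neutral_cong_left) (auto simp: I_def)
  ultimately show ?thesis
    using nn_integral_normal_sq_excess[OF _ \<sigma>, of M "\<lambda>\<omega>. (\<Sum>i<n. c i * \<epsilon> i \<omega>) / l" y] by (simp add: l_def)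
qed

section \<open>Nets around a centre and the deterministic noise estimate\<close>

text \<open>Coordinates in the ball are at most \<open>8 * \<sigma> * n\<close> in absolute value,
  so at mesh \<open>\<sigma> / sqrt n\<close> the base of the entropy bound is
  \<open>4 + 16 * n ^ 2\<close>, which is at most \<open>n ^ 5\<close> for \<open>n \<ge> 7\<close>.
  The resulting exponent \<open>5 * \<kappa> * t\<close> lies far below the one provided for in the
  penalty.\<close>

lemma localized_entropy_net:
  assumes \<kappa>: "entropy_constant \<kappa>" and n: "n \<ge> 7" and \<sigma>: "\<sigma> > 0"
    and V: "pdim_at_most n V t" and t: "real t \<le> D"
  obtains C where "finite C" "real (card C) \<le> exp (9 * 2 ^ 15 * \<kappa> * D * ln (real n))"
    "\<And>v. v \<in> V \<Longrightarrow> L2_set (\<lambda>i. v i - w i) {..<n} \<le> 8 * \<sigma> * real n \<Longrightarrow>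
      \<exists>c\<in>C. L2_set (\<lambda>i. v i - w i - c i) {..<n} \<le> \<sigma> / sqrt (real n)"
proof -
  define shift where "shift v = (\<lambda>i\<in>{..<n}. v i - w i)" for v :: "nat \<Rightarrow> real"
  define U where "U = shift ` {v \<in> V. L2_set (\<lambda>i. v i - w i) {..<n} \<le> 8 * \<sigma> * real n}"
  have "U \<subseteq> ({..<n} \<rightarrow>\<^sub>E UNIV)" by (auto simp: U_def shift_def split: if_splits)
  moreover have "\<bar>u i\<bar> \<le> 8 * \<sigma> * real n" if "u \<in> U" "i < n" for u i
  proof -
    obtain v where "u = shift v" "L2_set (\<lambda>i. v i - w i) {..<n} \<le> 8 * \<sigma> * real n"
      using \<open>u \<in> U\<close> by (auto simp: U_def)
    moreover have "\<bar>v i - w i\<bar> \<le> L2_set (\<lambda>i. v i - w i) {..<n}"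
      using member_le_L2_set[of "{..<n}" i "\<lambda>i. \<bar>v i - w i\<bar>"] \<open>i < n\<close> by (simp add: L2_set_def)
    ultimately show ?thesis using \<open>i < n\<close> by (simp add: shift_def)
  qed
  moreover have "pdim_at_most n U t"
    by (rule pdim_at_most_translate[OF V, of _ w]) (auto simp: U_def shift_def)
  moreover have "0 < \<sigma> / sqrt (real n)" using n \<sigma> by simp
  ultimately obtain C where C: "finite C"
    "\<And>u. u \<in> U \<Longrightarrow> \<exists>c\<in>C. L2_set (\<lambda>i. u i - c i) {..<n} \<le> \<sigma> / sqrt (real n)"
    "real (card C) \<le> (4 + 2 * (8 * \<sigma> * real n) * sqrt (real n) / (\<sigma> / sqrt (real n))) powr (\<kappa> * real t)"
    using entropy_net[OF \<kappa>, of U n "8 * \<sigma> * real n" t "\<sigma> / sqrt (real n)"] by blast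
  have \<kappa>1: "\<kappa> \<ge> 1" using \<kappa> by (simp add: entropy_constant_def)
  have "2 * (8 * \<sigma> * real n) * sqrt (real n) / (\<sigma> / sqrt (real n)) = 16 * (real n)\<^sup>2"
    using n \<sigma> by (simp add: field_simps power2_eq_square)
  moreover have "4 + 16 * (real n)\<^sup>2 \<le> real n ^ 5"
  proof -
    have "4 + 16 * (real n)\<^sup>2 \<le> 7 ^ 3 * (real n)\<^sup>2"
      using mult_mono[of 7 "real n" 7 "real n"] n by (simp add: power2_eq_square)
    also have "\<dots> \<le> real n ^ 3 * (real n)\<^sup>2"
      using n by (intro mult_right_mono power_mono) auto
    finally show ?thesis by (simp flip: power_add)
  qed
  ultimately have "real (card C) \<le> (real n ^ 5) powr (\<kappa> * real t)"
    using C(3) \<kappa>1 by (elim order_trans) (auto intro!: powr_mono2)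
  also have "\<dots> = exp (5 * \<kappa> * real t * ln (real n))"
    using n by (simp add: powr_def ln_realpow)
  also have "\<dots> \<le> exp (9 * 2 ^ 15 * \<kappa> * D * ln (real n))"
    using n \<kappa>1 t by (simp add: mult_mono)
  finally have "real (card C) \<le> exp (9 * 2 ^ 15 * \<kappa> * D * ln (real n))" .
  moreover have "\<exists>c\<in>C. L2_set (\<lambda>i. v i - w i - c i) {..<n} \<le> \<sigma> / sqrt (real n)"
    if "v \<in> V" "L2_set (\<lambda>i. v i - w i) {..<n} \<le> 8 * \<sigma> * real n" for v
  proof -
    have "L2_set (\<lambda>i. shift v i - c i) {..<n} = L2_set (\<lambda>i. v i - w i - c i) {..<n}" for c
      by (intro L2_set_cong) (auto simp: shift_def)
    moreover have "shift v \<in> U" using that by (auto simp: U_def)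
    ultimately show ?thesis using C(2) by fastforce
  qed
  ultimately show thesis using C(1) that by blast
qed

lemma sum_mult_le_L2_set: "(\<Sum>i\<in>A. f i * g i) \<le> L2_set f A * L2_set g A"
  by (rule order_trans[OF sum_mono L2_set_mult_ineq]) (simp flip: abs_mult)

text \<open>The right side does not involve \<open>u\<close>, so one bound serves all
  \<open>u\<close> with the same net \<open>C\<close>. The quarter of the squared norm is what
  absorbs the part of the inner product that is linear in \<open>U\<close>.\<close>

lemma noise_term_le:
  fixes e u :: "nat \<Rightarrow> real"
  assumes n: "n > 0" and \<sigma>: "\<sigma> > 0" and q: "q \<ge> 0" and C: "finite C"
    and net: "L2_set u {..<n} \<le> 8 * \<sigma> * real n \<Longrightarrow>
      \<exists>c\<in>C. L2_set (\<lambda>i. u i - c i) {..<n} \<le> \<sigma> / sqrt (real n)"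
  defines "E \<equiv> L2_set e {..<n}"
  shows "2 * (\<Sum>i<n. e i * u i) - (\<Sum>i<n. (u i)\<^sup>2) / 4 - q
    \<le> (4 * E ^ 4 / (\<sigma>\<^sup>2 * (real n)\<^sup>2) + 2 * (E\<^sup>2 / real n + \<sigma>\<^sup>2))
      + (\<Sum>c\<in>C. max 0 (4 * ((\<Sum>i<n. c i * e i) / L2_set c {..<n})\<^sup>2 - q))"
    (is "?lhs \<le> ?R + ?N")
proof -
  define U where "U = L2_set u {..<n}"
  have U2: "(\<Sum>i<n. (u i)\<^sup>2) = U\<^sup>2" by (simp add: U_def L2_set_def sum_nonneg)
  have nonneg: "U \<ge> 0" "E \<ge> 0" "?N \<ge> 0" by (auto simp: U_def E_def intro!: sum_nonneg)
  have fourth: "0 \<le> 4 * E ^ 4 / (\<sigma>\<^sup>2 * (real n)\<^sup>2)" by simp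
  have second: "0 \<le> 2 * (E\<^sup>2 / real n + \<sigma>\<^sup>2)" by simp
  have eu: "(\<Sum>i<n. e i * u i) \<le> E * U" unfolding E_def U_def by (rule sum_mult_le_L2_set)
  consider "E > \<sigma> * real n" | "E \<le> \<sigma> * real n" "U > 8 * \<sigma> * real n" | "U \<le> 8 * \<sigma> * real n"
    by linarith
  then show ?thesis
  proof cases
    \<comment> \<open>Very large noise: completing the square leaves \<open>4 * E\<^sup>2\<close>,
      and \<open>E > \<sigma> * n\<close> allows the passage to the fourth power.\<close>
    case 1
    have "2 * (E * U) - U\<^sup>2 / 4 \<le> 4 * E\<^sup>2"
      using zero_le_power2[of "U / 2 - 2 * E"] by (simp add: power2_eq_square algebra_simps)
    also have "4 * E\<^sup>2 \<le> 4 * E ^ 4 / (\<sigma>\<^sup>2 * (real n)\<^sup>2)"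
    proof -
      have "(\<sigma> * real n)\<^sup>2 \<le> E\<^sup>2" using 1 \<sigma> by (intro power_mono) auto
      then have "4 * E\<^sup>2 * (\<sigma>\<^sup>2 * (real n)\<^sup>2) \<le> 4 * E\<^sup>2 * E\<^sup>2"
        by (intro mult_left_mono) (auto simp: power_mult_distrib)
      moreover have "4 * E\<^sup>2 * E\<^sup>2 = 4 * E ^ 4" by (simp add: mult.assoc flip: power_add)
      ultimately show ?thesis using n \<sigma> by (subst pos_le_divide_eq) auto
    qed
    finally show ?thesis using eu U2 nonneg second q by linarith
  next
    \<comment> \<open>Moderate noise and distant \<open>u\<close>: as \<open>U \<ge> 8 * E\<close>,
      the quadratic term absorbs the linear one.\<close>
    case 2
    then have "8 * E \<le> U" by linarith
    then have "U * (8 * E) \<le> U * U" using nonneg by (intro mult_left_mono) auto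
    then have "2 * (E * U) - U\<^sup>2 / 4 \<le> 0" by (simp add: power2_eq_square algebra_simps)
    then show ?thesis using eu U2 nonneg second fourth q by linarith
  next
    \<comment> \<open>Inside the ball \<open>u\<close> is replaced by a net point \<open>c\<close>,
      whatever the size of \<open>E\<close>.\<close>
    case 3
    define d where "d = \<sigma> / sqrt (real n)"
    obtain c where c: "c \<in> C" "L2_set (\<lambda>i. u i - c i) {..<n} \<le> d"
      using net 3 by (auto simp: U_def d_def)
    define l where "l = L2_set c {..<n}"
    define Z where "Z = (\<Sum>i<n. c i * e i) / l"
    have "l \<ge> 0" "d > 0" using n \<sigma> by (auto simp: l_def d_def)
    have ce: "\<bar>\<Sum>i<n. c i * e i\<bar> \<le> l * E"
      unfolding l_def E_def
      by (rule order_trans[OF sum_abs]) (use L2_set_mult_ineq[of c e "{..<n}"] in \<open>simp add: abs_mult\<close>)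
    then have ceZ: "\<bar>\<Sum>i<n. c i * e i\<bar> = l * \<bar>Z\<bar>"
    proof (cases "l = 0")
      case True
      then show ?thesis using ce by simp
    next
      case False
      then show ?thesis using \<open>l \<ge> 0\<close> by (simp add: Z_def abs_divide)
    qed
    \<comment> \<open>This is Cauchy-Schwarz; for \<open>l = 0\<close> the value
      \<open>Z = 0\<close> comes from division by zero.\<close>
    have ZE: "\<bar>Z\<bar> \<le> E"
    proof (cases "l = 0")
      case True
      then show ?thesis using nonneg by (simp add: Z_def)
    next
      case False
      then show ?thesis using ce \<open>l \<ge> 0\<close> unfolding ceZ by simp
    qed
    have l: "l \<le> U + d"
    proof -
      have "l = L2_set (\<lambda>i. u i + (c i - u i)) {..<n}" by (simp add: l_def)
      also have "\<dots> \<le> U + L2_set (\<lambda>i. c i - u i) {..<n}"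
        unfolding U_def by (rule L2_set_triangle_ineq)
      also have "L2_set (\<lambda>i. c i - u i) {..<n} = L2_set (\<lambda>i. u i - c i) {..<n}"
        by (simp add: L2_set_def power2_commute)
      finally show ?thesis using c by simp
    qed
    have "(\<Sum>i<n. e i * u i) = (\<Sum>i<n. c i * e i) + (\<Sum>i<n. e i * (u i - c i))"
      by (simp add: algebra_simps flip: sum.distrib)
    also have "\<dots> \<le> l * \<bar>Z\<bar> + E * d"
    proof (rule add_mono)
      have "(\<Sum>i<n. e i * (u i - c i)) \<le> E * L2_set (\<lambda>i. u i - c i) {..<n}"
        unfolding E_def by (rule sum_mult_le_L2_set)
      also have "\<dots> \<le> E * d" using c nonneg by (intro mult_left_mono) auto
      finally show "(\<Sum>i<n. e i * (u i - c i)) \<le> E * d" .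
    qed (use ceZ in linarith)
    \<comment> \<open>Passing from \<open>l\<close> to \<open>U\<close> costs a further
      \<open>E * d\<close>, whence the factor 2 in the net error.\<close>
    also have "\<dots> \<le> U * \<bar>Z\<bar> + 2 * (E * d)"
    proof -
      have "l * \<bar>Z\<bar> \<le> U * \<bar>Z\<bar> + \<bar>Z\<bar> * d"
        using mult_right_mono[OF l, of "\<bar>Z\<bar>"] by (simp add: algebra_simps)
      moreover have "\<bar>Z\<bar> * d \<le> E * d" using ZE \<open>d > 0\<close> by simp
      ultimately show ?thesis by linarith
    qed
    finally have 1: "(\<Sum>i<n. e i * u i) \<le> U * \<bar>Z\<bar> + 2 * (E * d)" .
    have 2: "2 * (U * \<bar>Z\<bar>) \<le> U\<^sup>2 / 4 + 4 * Z\<^sup>2"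
      using zero_le_power2[of "U / 2 - 2 * \<bar>Z\<bar>"] by (simp add: power2_eq_square algebra_simps)
    have "0 \<le> (E / sqrt (real n) - \<sigma>)\<^sup>2" by simp
    also have "\<dots> = E\<^sup>2 / real n + \<sigma>\<^sup>2 - 2 * (E * d)"
      by (simp add: d_def power2_diff power_divide)
    finally have 3: "4 * (E * d) \<le> 2 * (E\<^sup>2 / real n + \<sigma>\<^sup>2)" by simp
    have "4 * Z\<^sup>2 - q \<le> max 0 (4 * ((\<Sum>i<n. c i * e i) / L2_set c {..<n})\<^sup>2 - q)"
      by (simp add: Z_def l_def)
    \<comment> \<open>The point \<open>c\<close> depends on \<open>u\<close>; summing positive parts
      over all of \<open>C\<close> removes this dependence.\<close>
    also have "\<dots> \<le> ?N" using C c(1) by (intro member_le_sum) auto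
    finally show ?thesis using 1 2 3 U2 fourth by linarith
  qed
qed

section \<open>Penalized least squares at a fixed realization\<close>

text \<open>The selected estimator has penalized contrast at most that of \<open>f m\<close>, hence
  of \<open>g\<close>; expanding the squares around \<open>f0\<close> leaves only the noise tested
  against \<open>u\<close>. The term in the squared norm of \<open>u\<close> is gained by giving up
  a part of the loss itself.\<close>

lemma penalized_least_squares_basic_inequality:
  fixes x :: "nat \<Rightarrow> 'a" and e y pen :: "nat \<Rightarrow> real"
  assumes n: "n > 0" and y: "\<And>i. i < n \<Longrightarrow> y i = f0 (x i) + e i"
    and f: "\<And>m. is_arg_min (emp_risk n (x, y)) (\<lambda>f. f \<in> P m) (f m)"
    and k: "is_arg_min (\<lambda>m. contrast n (x, y) (f m) + pen m) (\<lambda>_. True) k"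
    and g: "g \<in> P m"
  defines "u \<equiv> \<lambda>i. f k (x i) - g (x i)"
  shows "emp_sq_dist n x (f k) f0 \<le> 3 * emp_sq_dist n x g f0 + 2 * pen m
    + 2 / real n * (2 * (\<Sum>i<n. e i * u i) - (\<Sum>i<n. (u i)\<^sup>2) / 4 - real n * pen k)"
proof -
  define A where "A h = (\<Sum>i<n. (h (x i) - f0 (x i))\<^sup>2)" for h :: "'a \<Rightarrow> real"
  \<comment> \<open>The difference does not depend on \<open>h\<close>, so empirical risk and
    contrast have the same minimizers.\<close>
  have risk: "emp_risk n (x, y) h = contrast n (x, y) h + (1 / real n) * (\<Sum>i<n. (y i)\<^sup>2)" for h
    unfolding emp_risk_def contrast_def using n
    by (simp add: field_simps power2_diff sum.distrib sum_subtractf sum_distrib_left)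
  have contrast: "real n * contrast n (x, y) h
      = A h - (\<Sum>i<n. (f0 (x i))\<^sup>2) - 2 * (\<Sum>i<n. e i * h (x i))" for h
  proof -
    have "real n * contrast n (x, y) h = (\<Sum>i<n. (h (x i))\<^sup>2) - 2 * (\<Sum>i<n. y i * h (x i))"
      using n by (simp add: contrast_def field_simps)
    also have "\<dots> = (\<Sum>i<n. (h (x i))\<^sup>2 - 2 * ((f0 (x i) + e i) * h (x i)))"
      using y by (simp add: sum_subtractf sum_distrib_left)
    also have "\<dots> = (\<Sum>i<n. (h (x i) - f0 (x i))\<^sup>2 - (f0 (x i))\<^sup>2 - 2 * (e i * h (x i)))"
      by (intro sum.cong) (auto simp: power2_eq_square algebra_simps)
    finally show ?thesis by (simp add: A_def sum_subtractf sum_distrib_left)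
  qed
  have "contrast n (x, y) (f k) + pen k \<le> contrast n (x, y) (f m) + pen m"
    using k by (auto simp: is_arg_min_def not_less)
  also have "contrast n (x, y) (f m) \<le> contrast n (x, y) g"
    using f[of m] g risk by (auto simp: is_arg_min_def not_less)
  finally have "real n * (contrast n (x, y) (f k) + pen k) \<le> real n * (contrast n (x, y) g + pen m)"
    by (intro mult_left_mono) auto
  then have 1: "A (f k) \<le> A g + 2 * (\<Sum>i<n. e i * u i) + real n * pen m - real n * pen k"
    using contrast[of "f k"] contrast[of g]
    by (simp add: u_def algebra_simps sum_subtractf)
  have "(\<Sum>i<n. (u i)\<^sup>2) \<le> (\<Sum>i<n. 2 * (f k (x i) - f0 (x i))\<^sup>2 + 2 * (g (x i) - f0 (x i))\<^sup>2)"
  proof (rule sum_mono)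
    fix i
    show "(u i)\<^sup>2 \<le> 2 * (f k (x i) - f0 (x i))\<^sup>2 + 2 * (g (x i) - f0 (x i))\<^sup>2"
      using zero_le_power2[of "(f k (x i) - f0 (x i)) + (g (x i) - f0 (x i))"]
      by (simp add: u_def power2_eq_square algebra_simps)
  qed
  then have 2: "(\<Sum>i<n. (u i)\<^sup>2) \<le> 2 * A (f k) + 2 * A g"
    by (simp add: A_def sum.distrib sum_distrib_left)
  \<comment> \<open>Twice the first inequality leaves a spare \<open>A (f k)\<close>. Half of the
    second bounds \<open>- A (f k)\<close> by \<open>A g\<close> minus half the squared norm of
    \<open>u\<close>, which gives the factor 3 and the quarter inside the doubled bracket.\<close>
  have "A (f k) \<le> 3 * A g + 2 * real n * pen m
      + 2 * (2 * (\<Sum>i<n. e i * u i) - (\<Sum>i<n. (u i)\<^sup>2) / 4 - real n * pen k)"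
    using 1 2 by (simp add: algebra_simps)
  then have "A (f k) / real n \<le> (3 * A g + 2 * real n * pen m
      + 2 * (2 * (\<Sum>i<n. e i * u i) - (\<Sum>i<n. (u i)\<^sup>2) / 4 - real n * pen k)) / real n"
    by (intro divide_right_mono) auto
  then show ?thesis
    using n by (simp add: emp_sq_dist_def A_def add_divide_distrib)
qed

section \<open>Expected noise at a fixed design\<close>

text \<open>Cauchy-Schwarz bounds \<open>E ^ 4\<close> by \<open>n\<close> times the sum of the
  fourth powers, so only marginal moments enter. The fourth moment \<open>3 * \<sigma> ^ 4\<close>
  contributes \<open>12 * \<sigma>\<^sup>2\<close> and the second-order part
  \<open>4 * \<sigma>\<^sup>2\<close>.\<close>

lemma (in prob_space) nn_integral_noise_moments:
  fixes \<epsilon> :: "nat \<Rightarrow> 'a \<Rightarrow> real"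
  assumes n: "n > 0" and \<sigma>: "\<sigma> > 0"
    and normal: "\<And>i. i < n \<Longrightarrow> distributed M lborel (\<epsilon> i) (\<lambda>z. ennreal (normal_density 0 \<sigma> z))"
  defines "E \<equiv> \<lambda>\<omega>. L2_set (\<lambda>i. \<epsilon> i \<omega>) {..<n}"
  shows "(\<integral>\<^sup>+\<omega>. ennreal (4 * E \<omega> ^ 4 / (\<sigma>\<^sup>2 * (real n)\<^sup>2) + 2 * ((E \<omega>)\<^sup>2 / real n + \<sigma>\<^sup>2)) \<partial>M)
    \<le> ennreal (16 * \<sigma>\<^sup>2)"
proof -
  have moment: "has_bochner_integral M (\<lambda>\<omega>. \<epsilon> i \<omega> ^ (2 * k)) (fact (2 * k) / ((2 / \<sigma>\<^sup>2) ^ k * fact k))"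
    if "i < n" for i k
  proof -
    have "integrable M (\<lambda>\<omega>. \<epsilon> i \<omega> ^ (2 * k))"
      using distributed_integrable[OF normal[OF that], of "\<lambda>z. z ^ (2 * k)"] normal_moment_even[OF \<sigma>, of 0 k]
      by (simp add: has_bochner_integral_iff)
    moreover have "(\<integral>\<omega>. \<epsilon> i \<omega> ^ (2 * k) \<partial>M) = fact (2 * k) / ((2 / \<sigma>\<^sup>2) ^ k * fact k)"
      using distributed_integral[OF normal[OF that], of "\<lambda>z. z ^ (2 * k)"] integral_normal_moment_even[OF \<sigma>, of 0 k]
      by simp
    ultimately show ?thesis by (simp add: has_bochner_integral_iff)
  qed
  have m2: "has_bochner_integral M (\<lambda>\<omega>. (\<epsilon> i \<omega>)\<^sup>2) (\<sigma>\<^sup>2)" if "i < n" for i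
    using moment[OF that, of 1] by (simp add: fact_numeral)
  have m4: "has_bochner_integral M (\<lambda>\<omega>. \<epsilon> i \<omega> ^ 4) (3 * \<sigma> ^ 4)" if "i < n" for i
    using moment[OF that, of 2] \<sigma> by (simp add: fact_numeral power_divide flip: power_mult)
  have E2: "(E \<omega>)\<^sup>2 = (\<Sum>i<n. (\<epsilon> i \<omega>)\<^sup>2)" for \<omega>
    by (simp add: E_def L2_set_def sum_nonneg)
  define F where "F \<omega> = 4 * (real n * (\<Sum>i<n. \<epsilon> i \<omega> ^ 4)) / (\<sigma>\<^sup>2 * (real n)\<^sup>2)
      + 2 * ((\<Sum>i<n. (\<epsilon> i \<omega>)\<^sup>2) / real n + \<sigma>\<^sup>2)" for \<omega>
  have "has_bochner_integral M F (4 * (real n * (\<Sum>i<n. 3 * \<sigma> ^ 4)) / (\<sigma>\<^sup>2 * (real n)\<^sup>2)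
      + 2 * ((\<Sum>i<n. \<sigma>\<^sup>2) / real n + measure M (space M) * \<sigma>\<^sup>2))"
    unfolding F_def
    by (intro has_bochner_integral_add has_bochner_integral_divide_zero
        has_bochner_integral_mult_right has_bochner_integral_sum m2 m4) 
       (auto simp: has_bochner_integral_iff)
  moreover have "4 * (real n * (\<Sum>i<n. 3 * \<sigma> ^ 4)) / (\<sigma>\<^sup>2 * (real n)\<^sup>2)
      + 2 * ((\<Sum>i<n. \<sigma>\<^sup>2) / real n + measure M (space M) * \<sigma>\<^sup>2) = 16 * \<sigma>\<^sup>2"
    using n \<sigma> by (simp add: prob_space field_simps eval_nat_numeral)
  ultimately have F: "has_bochner_integral M F (16 * \<sigma>\<^sup>2)" by simp
  have "4 * E \<omega> ^ 4 / (\<sigma>\<^sup>2 * (real n)\<^sup>2) + 2 * ((E \<omega>)\<^sup>2 / real n + \<sigma>\<^sup>2) \<le> F \<omega>" for \<omega>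
  proof -
    have "E \<omega> ^ 4 = (\<Sum>i<n. (\<epsilon> i \<omega>)\<^sup>2)\<^sup>2"
      by (simp flip: E2 power_mult)
    also have "\<dots> \<le> real n * (\<Sum>i<n. ((\<epsilon> i \<omega>)\<^sup>2)\<^sup>2)"
      using sum_squared_le_sum_of_squares[of "\<lambda>i. (\<epsilon> i \<omega>)\<^sup>2" "{..<n}"]
      by (simp add: mult.commute)
    finally have "E \<omega> ^ 4 \<le> real n * (\<Sum>i<n. \<epsilon> i \<omega> ^ 4)" by (simp flip: power_mult)
    then show ?thesis unfolding F_def E2 by (intro add_right_mono divide_right_mono mult_left_mono) auto
  qed
  then have "(\<integral>\<^sup>+\<omega>. ennreal (4 * E \<omega> ^ 4 / (\<sigma>\<^sup>2 * (real n)\<^sup>2) + 2 * ((E \<omega>)\<^sup>2 / real n + \<sigma>\<^sup>2)) \<partial>M)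
      \<le> (\<integral>\<^sup>+\<omega>. ennreal (F \<omega>) \<partial>M)"
    by (intro nn_integral_mono ennreal_leI)
  also have "\<dots> = ennreal (16 * \<sigma>\<^sup>2)"
  proof -
    have "F \<omega> \<ge> 0" for \<omega>
      unfolding F_def by (intro add_nonneg_nonneg mult_nonneg_nonneg divide_nonneg_nonneg sum_nonneg) auto
    then show ?thesis using F by (subst nn_integral_eq_integral) (auto simp: has_bochner_integral_iff)
  qed
  finally show ?thesis .
qed

text \<open>A single measurable \<open>R\<close> dominates the noise term of all models and all
  their elements, so a model and an estimator chosen from the data may be inserted afterwards. This
  avoids the measurability of a supremum over an uncountable model.\<close>

lemma (in prob_space) fixed_design_noise_bound:
  fixes \<epsilon> :: "nat \<Rightarrow> 'a \<Rightarrow> real" and V :: "nat \<Rightarrow> (nat \<Rightarrow> real) set" and L D :: "nat \<Rightarrow> real"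
  assumes \<kappa>: "entropy_constant \<kappa>" and n: "n \<ge> 7" and \<sigma>: "\<sigma> > 0"
    and indep: "indep_vars (\<lambda>_. borel) \<epsilon> {..<n}"
    and normal: "\<And>i. i < n \<Longrightarrow> distributed M lborel (\<epsilon> i) (\<lambda>z. ennreal (normal_density 0 \<sigma> z))"
    and V: "\<And>m. real (pdim n (V m)) \<le> D m" and D: "\<And>m. D m \<ge> 1" and L: "\<And>m. L m \<ge> 1"
    and S: "(\<lambda>m. exp (- L m * D m)) sums S"
  obtains R :: "(nat \<Rightarrow> real) \<Rightarrow> ennreal"
  where "R \<in> borel_measurable (\<Pi>\<^sub>M i\<in>{..<n}. borel)"
    "(\<integral>\<^sup>+\<omega>. R (sample n \<epsilon> \<omega>) \<partial>M) \<le> ennreal (16 * \<sigma>\<^sup>2 * (1 + S))"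
    "\<forall>e m. \<forall>v\<in>V m. ennreal (2 * (\<Sum>i<n. e i * (v i - w i)) - (\<Sum>i<n. (v i - w i)\<^sup>2) / 4
        - real n * penalty \<kappa> \<sigma> n L D m) \<le> R e"
proof -
  define q where "q m = real n * penalty \<kappa> \<sigma> n L D m" for m
  \<comment> \<open>The level for the Gaussian excess bound: its part with \<open>\<kappa>\<close>
    pays for the size of the net, its part \<open>L m * D m\<close> for the sum over the
    models.\<close>
  define y where "y m = D m * (9 * 2 ^ 15 * \<kappa> * ln (real n) + L m)" for m
  have \<kappa>1: "\<kappa> \<ge> 1" using \<kappa> by (simp add: entropy_constant_def)
  have q_eq: "q m = 16 * \<sigma>\<^sup>2 * y m" for m
    using n by (simp add: q_def y_def penalty_def)
  have ln_n: "ln (real n) \<ge> 0" using n by simp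
  have y0: "y m \<ge> 0" for m
    unfolding y_def using D[of m] L[of m] \<kappa>1 ln_n by (intro mult_nonneg_nonneg add_nonneg_nonneg) auto
  have q0: "q m \<ge> 0" for m using y0[of m] by (simp add: q_eq)
  define net where "net m C \<longleftrightarrow> finite C \<and> real (card C) \<le> exp (9 * 2 ^ 15 * \<kappa> * D m * ln (real n)) \<and>
    (\<forall>v\<in>V m. L2_set (\<lambda>i. v i - w i) {..<n} \<le> 8 * \<sigma> * real n \<longrightarrow>
      (\<exists>c\<in>C. L2_set (\<lambda>i. v i - w i - c i) {..<n} \<le> \<sigma> / sqrt (real n)))" for m and C :: "(nat \<Rightarrow> real) set"
  have "\<exists>C. net m C" for m
  proof (rule localized_entropy_net[OF \<kappa> n \<sigma> pdim_at_most_pdim V, of m w])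
    fix C assume "finite C" "real (card C) \<le> exp (9 * 2 ^ 15 * \<kappa> * D m * ln (real n))"
      "\<And>v. v \<in> V m \<Longrightarrow> L2_set (\<lambda>i. v i - w i) {..<n} \<le> 8 * \<sigma> * real n \<Longrightarrow>
        \<exists>c\<in>C. L2_set (\<lambda>i. v i - w i - c i) {..<n} \<le> \<sigma> / sqrt (real n)"
    then show "\<exists>C. net m C" unfolding net_def by blast
  qed
  then obtain C where net: "\<And>m. net m (C m)"
    using choice[of net] by blast
  have C: "finite (C m)" "real (card (C m)) \<le> exp (9 * 2 ^ 15 * \<kappa> * D m * ln (real n))"
    "\<And>v. v \<in> V m \<Longrightarrow> L2_set (\<lambda>i. v i - w i) {..<n} \<le> 8 * \<sigma> * real n \<Longrightarrow>
      \<exists>c\<in>C m. L2_set (\<lambda>i. v i - w i - c i) {..<n} \<le> \<sigma> / sqrt (real n)" for m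
    using net[of m] unfolding net_def by blast+
  define E where "E e = L2_set e {..<n}" for e :: "nat \<Rightarrow> real"
  define T where "T c e m = 4 * ((\<Sum>i<n. c i * e i) / L2_set c {..<n})\<^sup>2 - q m" for c e :: "nat \<Rightarrow> real" and m
  define R0 where "R0 e = 4 * E e ^ 4 / (\<sigma>\<^sup>2 * (real n)\<^sup>2) + 2 * ((E e)\<^sup>2 / real n + \<sigma>\<^sup>2)" for e
  \<comment> \<open>The series over all models and net points replaces the unknown selected one;
    \<open>ennreal\<close> turns each \<open>T c e m\<close> into its positive part.\<close>
  define R where "R e = ennreal (R0 e) + (\<Sum>m. \<Sum>c\<in>C m. ennreal (T c e m))" for e
  have [measurable]: "E \<in> borel_measurable (\<Pi>\<^sub>M i\<in>{..<n}. borel)"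
    unfolding E_def[abs_def] L2_set_def by measurable
  have [measurable]: "R0 \<in> borel_measurable (\<Pi>\<^sub>M i\<in>{..<n}. borel)"
    unfolding R0_def[abs_def] by measurable
  have T[measurable]: "(\<lambda>e. T c e m) \<in> borel_measurable (\<Pi>\<^sub>M i\<in>{..<n}. borel)" for c m
    unfolding T_def by measurable
  have \<epsilon>_meas: "\<epsilon> i \<in> borel_measurable M" if "i \<in> {..<n}" for i
    using indep that by (auto simp: indep_vars_def)
  have [measurable]: "sample n \<epsilon> \<in> measurable M (\<Pi>\<^sub>M i\<in>{..<n}. borel)"
    unfolding sample_def[abs_def] by (intro measurable_restrict \<epsilon>_meas)
  show thesis
  proof (rule that)
    show "R \<in> borel_measurable (\<Pi>\<^sub>M i\<in>{..<n}. borel)"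
      unfolding R_def[abs_def] by measurable
    have R0_int: "(\<integral>\<^sup>+\<omega>. ennreal (R0 (sample n \<epsilon> \<omega>)) \<partial>M) \<le> ennreal (16 * \<sigma>\<^sup>2)"
    proof -
      have "E (sample n \<epsilon> \<omega>) = L2_set (\<lambda>i. \<epsilon> i \<omega>) {..<n}" for \<omega>
        unfolding E_def by (intro L2_set_cong) (auto simp: sample_def)
      then show ?thesis
        using nn_integral_noise_moments[of n \<sigma> \<epsilon>] n \<sigma> normal by (simp add: R0_def)
    qed
    have "(\<integral>\<^sup>+\<omega>. ennreal (T c (sample n \<epsilon> \<omega>) m) \<partial>M) \<le> ennreal (16 * \<sigma>\<^sup>2 * exp (- y m))" for c m
    proof -
      have "(\<Sum>i<n. c i * sample n \<epsilon> \<omega> i) = (\<Sum>i<n. c i * \<epsilon> i \<omega>)" for \<omega>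
        by (intro sum.cong) (auto simp: sample_def)
      then show ?thesis
        using nn_integral_normal_direction_sq_excess[OF indep \<sigma> y0[of m] normal, of c] by (simp add: T_def q_eq)
    qed
    then have "(\<Sum>m. \<Sum>c\<in>C m. \<integral>\<^sup>+\<omega>. ennreal (T c (sample n \<epsilon> \<omega>) m) \<partial>M)
        \<le> (\<Sum>m. \<Sum>c\<in>C m. ennreal (16 * \<sigma>\<^sup>2 * exp (- y m)))"
      by (intro suminf_le sum_mono) auto
    also have "\<dots> \<le> (\<Sum>m. ennreal (16 * \<sigma>\<^sup>2 * exp (- L m * D m)))"
    proof (intro suminf_le)
      fix m
      \<comment> \<open>The entropy part of \<open>y m\<close> cancels the cardinality exactly as
        bounded, leaving the summable weight.\<close>
      have "real (card (C m)) * exp (- y m)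
          \<le> exp (9 * 2 ^ 15 * \<kappa> * D m * ln (real n)) * exp (- y m)"
        using C(2) by (intro mult_right_mono) auto
      also have "\<dots> = exp (- L m * D m)"
        by (simp add: y_def algebra_simps flip: exp_add)
      finally have "real (card (C m)) * (16 * \<sigma>\<^sup>2 * exp (- y m)) \<le> 16 * \<sigma>\<^sup>2 * exp (- L m * D m)"
        using mult_left_mono[of "real (card (C m)) * exp (- y m)" "exp (- L m * D m)" "16 * \<sigma>\<^sup>2"]
        by (simp add: mult.left_commute)
      then show "(\<Sum>c\<in>C m. ennreal (16 * \<sigma>\<^sup>2 * exp (- y m))) \<le> ennreal (16 * \<sigma>\<^sup>2 * exp (- L m * D m))"
        by (subst sum_ennreal) (auto simp: ennreal_leI)
    qed auto
    also have "\<dots> = ennreal (16 * \<sigma>\<^sup>2 * S)"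
      using sums_mult[OF S, of "16 * \<sigma>\<^sup>2"] by (intro suminf_ennreal_eq) auto
    finally have "(\<Sum>m. \<Sum>c\<in>C m. \<integral>\<^sup>+\<omega>. ennreal (T c (sample n \<epsilon> \<omega>) m) \<partial>M) \<le> ennreal (16 * \<sigma>\<^sup>2 * S)" .
    note T_int = this
    have "S \<ge> 0" by (rule sums_le[OF _ sums_zero S]) simp
    have "(\<integral>\<^sup>+\<omega>. R (sample n \<epsilon> \<omega>) \<partial>M) = (\<integral>\<^sup>+\<omega>. ennreal (R0 (sample n \<epsilon> \<omega>)) \<partial>M)
        + (\<Sum>m. \<Sum>c\<in>C m. \<integral>\<^sup>+\<omega>. ennreal (T c (sample n \<epsilon> \<omega>) m) \<partial>M)"
      unfolding R_def by (simp add: nn_integral_add nn_integral_suminf nn_integral_sum)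
    then have "(\<integral>\<^sup>+\<omega>. R (sample n \<epsilon> \<omega>) \<partial>M) \<le> ennreal (16 * \<sigma>\<^sup>2) + ennreal (16 * \<sigma>\<^sup>2 * S)"
      using R0_int T_int by (simp add: add_mono)
    also have "\<dots> = ennreal (16 * \<sigma>\<^sup>2 * (1 + S))"
      using \<open>S \<ge> 0\<close> by (simp add: algebra_simps flip: ennreal_plus)
    finally show "(\<integral>\<^sup>+\<omega>. R (sample n \<epsilon> \<omega>) \<partial>M) \<le> ennreal (16 * \<sigma>\<^sup>2 * (1 + S))" .
  next
    have "ennreal (2 * (\<Sum>i<n. e i * (v i - w i)) - (\<Sum>i<n. (v i - w i)\<^sup>2) / 4
        - real n * penalty \<kappa> \<sigma> n L D m) \<le> R e" if v: "v \<in> V m" for e m v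
    proof -
      have "2 * (\<Sum>i<n. e i * (v i - w i)) - (\<Sum>i<n. (v i - w i)\<^sup>2) / 4 - q m
          \<le> R0 e + (\<Sum>c\<in>C m. max 0 (T c e m))"
        using noise_term_le[of n \<sigma> "q m" "C m" "\<lambda>i. v i - w i" e] n \<sigma> q0 C(1) C(3)[OF v]
        by (simp add: R0_def E_def T_def)
      then have "ennreal (2 * (\<Sum>i<n. e i * (v i - w i)) - (\<Sum>i<n. (v i - w i)\<^sup>2) / 4 - q m)
          \<le> ennreal (R0 e + (\<Sum>c\<in>C m. max 0 (T c e m)))"
        by (rule ennreal_leI)
      also have "\<dots> = ennreal (R0 e) + (\<Sum>c\<in>C m. ennreal (T c e m))"
      proof -
        have "R0 e \<ge> 0" by (simp add: R0_def)
        moreover have "ennreal (max 0 (T c e m)) = ennreal (T c e m)" for c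
          by (cases "T c e m \<ge> 0") (auto simp: max_def ennreal_neg)
        ultimately show ?thesis
          by (subst ennreal_plus) (auto simp: sum_nonneg simp flip: sum_ennreal)
      qed
      also have "\<dots> \<le> R e"
        unfolding R_def using sum_le_suminf[of "\<lambda>m. \<Sum>c\<in>C m. ennreal (T c e m)" "{m}"]
        by (intro add_mono) auto
      finally show ?thesis by (simp add: q_def)
    qed
    then show "\<forall>e m. \<forall>v\<in>V m. ennreal (2 * (\<Sum>i<n. e i * (v i - w i)) - (\<Sum>i<n. (v i - w i)\<^sup>2) / 4
        - real n * penalty \<kappa> \<sigma> n L D m) \<le> R e" by blast
  qed
qed

section \<open>Design averages, constants and the law of the data\<close>

text \<open>Cutting off at 0 costs equality once a summand is negative, as the noise excess over the
  penalty may be.\<close>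

lemma ennreal_add_le: "ennreal (a + b) \<le> ennreal a + ennreal b"
proof -
  have "a + b \<le> max 0 a + max 0 b" by linarith
  then have "ennreal (a + b) \<le> ennreal (max 0 a + max 0 b)" by (rule ennreal_leI)
  also have "\<dots> = ennreal a + ennreal b" by (simp add: max_def ennreal_neg)
  finally show ?thesis .
qed

text \<open>By linearity only the marginal law of each \<open>X i\<close> matters. Square
  integrability makes the Bochner integral in \<open>sq_dist\<close> agree with the nonnegative one
  instead of defaulting to 0.\<close>

lemma (in prob_space) nn_integral_emp_sq_dist:
  assumes n: "n > 0" and X: "\<And>i. i < n \<Longrightarrow> X i \<in> measurable M \<nu>"
    and X_distr: "\<And>i. i < n \<Longrightarrow> distr M \<nu> (X i) = \<nu>"
    and f: "f \<in> square_integrable \<nu>" and g: "g \<in> square_integrable \<nu>"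
  shows "(\<integral>\<^sup>+\<omega>. ennreal (emp_sq_dist n (sample n X \<omega>) f g) \<partial>M) = ennreal (sq_dist \<nu> f g)"
proof -
  have [measurable]: "f \<in> borel_measurable \<nu>" "g \<in> borel_measurable \<nu>"
    and "integrable \<nu> (\<lambda>x. (f x)\<^sup>2)" "integrable \<nu> (\<lambda>x. (g x)\<^sup>2)"
    using f g by (auto simp: square_integrable_def)
  then have "integrable \<nu> (\<lambda>x. 2 * (f x)\<^sup>2 + 2 * (g x)\<^sup>2)" by simp
  then have int: "integrable \<nu> (\<lambda>x. (f x - g x)\<^sup>2)"
  proof (rule Bochner_Integration.integrable_bound)
    have "(a - b)\<^sup>2 \<le> 2 * a\<^sup>2 + 2 * b\<^sup>2" for a b :: real
      using zero_le_power2[of "a + b"] by (simp add: power2_eq_square algebra_simps)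
    then show "AE x in \<nu>. norm ((f x - g x)\<^sup>2) \<le> norm (2 * (f x)\<^sup>2 + 2 * (g x)\<^sup>2)" by simp
  qed simp
  have marginal: "(\<integral>\<^sup>+\<omega>. ennreal ((f (X i \<omega>) - g (X i \<omega>))\<^sup>2) \<partial>M) = ennreal (sq_dist \<nu> f g)" if "i < n" for i
  proof -
    have "(\<integral>\<^sup>+\<omega>. ennreal ((f (X i \<omega>) - g (X i \<omega>))\<^sup>2) \<partial>M)
        = (\<integral>\<^sup>+x. ennreal ((f x - g x)\<^sup>2) \<partial>distr M \<nu> (X i))"
      using X[OF that] by (subst nn_integral_distr) auto
    then show ?thesis
      using int by (simp add: X_distr[OF that] sq_dist_def nn_integral_eq_integral)
  qed
  have meas[measurable]: "(\<lambda>\<omega>. ennreal ((f (X i \<omega>) - g (X i \<omega>))\<^sup>2)) \<in> borel_measurable M" if "i \<in> {..<n}" for i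
  proof -
    have [measurable]: "X i \<in> measurable M \<nu>" using X that by simp
    show ?thesis by measurable
  qed
  have "(\<integral>\<^sup>+\<omega>. ennreal (emp_sq_dist n (sample n X \<omega>) f g) \<partial>M)
      = (\<integral>\<^sup>+\<omega>. ennreal (1 / real n) * (\<Sum>i<n. ennreal ((f (X i \<omega>) - g (X i \<omega>))\<^sup>2)) \<partial>M)"
    by (intro nn_integral_cong) (simp add: emp_sq_dist_def sample_def sum_nonneg flip: ennreal_mult)
  also have "\<dots> = ennreal (1 / real n) * (\<integral>\<^sup>+\<omega>. (\<Sum>i<n. ennreal ((f (X i \<omega>) - g (X i \<omega>))\<^sup>2)) \<partial>M)"
    by (rule nn_integral_cmult) (intro borel_measurable_sum meas)
  also have "\<dots> = ennreal (1 / real n) * (\<Sum>i<n. ennreal (sq_dist \<nu> f g))"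
    by (subst nn_integral_sum[OF meas]) (auto simp: marginal simp del: sum_constant)
  also have "\<dots> = ennreal (sq_dist \<nu> f g)"
    using n by (subst sum_ennreal) (auto simp: sq_dist_def simp flip: ennreal_mult)
  finally show ?thesis .
qed

text \<open>With \<open>\<sigma>\<^sup>2 / n\<close> factored out, every term is raised to a
  multiple of \<open>L m * D m * ln n\<close>, because \<open>L m\<close>, \<open>D m\<close> and
  \<open>ln n\<close> are all at least 1. The coefficient of \<open>\<kappa>\<close> is
  \<open>32 * 9 * 2 ^ 15 = 9 * 2 ^ 20\<close>, that of \<open>S\<close> is 32, and the remaining 64
  fits under \<open>3.02 * 10 ^ 8\<close>.\<close>

lemma risk_bound_le_risk_constant:
  assumes n: "n \<ge> 7" and \<kappa>: "\<kappa> \<ge> 1" and D: "D m \<ge> 1" and L: "L m \<ge> (1::real)" and S: "S \<ge> 0"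
  shows "2 * penalty \<kappa> \<sigma> n L D m + 2 / real n * (16 * \<sigma>\<^sup>2 * (1 + S))
    \<le> risk_constant \<kappa> S * (\<sigma>\<^sup>2 * L m * D m * ln (real n) / real n)"
proof -
  define l where "l = ln (real n)"
  have "exp 1 \<le> real n" using n exp_le by linarith
  then have l: "l \<ge> 1" using n by (simp add: l_def ln_ge_iff)
  have LD: "L m * D m \<ge> 1" using D L mult_mono[of 1 "L m" 1 "D m"] by simp
  have Dl: "D m * l \<ge> 0" using D l by simp
  have DL0: "L m * D m \<ge> 0" using LD by simp
  have a: "D m * l \<le> L m * (D m * l)" using mult_right_mono[OF L Dl] by simp
  have b: "L m * D m \<le> L m * D m * l" using mult_left_mono[OF l DL0] by simp
  have c: "1 + S \<le> (1 + S) * (L m * D m * l)"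
    using mult_left_mono[of 1 "L m * D m * l" "1 + S"] LD b S by simp
  have d: "\<kappa> * (D m * l) \<le> \<kappa> * (L m * (D m * l))" using a \<kappa> by (intro mult_left_mono) auto
  have "32 * (D m * (9 * 2 ^ 15 * \<kappa> * l + L m)) + 32 * (1 + S)
      \<le> risk_constant \<kappa> S * (L m * D m * l)"
    using b c d LD by (simp add: risk_constant_def algebra_simps)
  then have "\<sigma>\<^sup>2 / real n * (32 * (D m * (9 * 2 ^ 15 * \<kappa> * l + L m)) + 32 * (1 + S))
      \<le> \<sigma>\<^sup>2 / real n * (risk_constant \<kappa> S * (L m * D m * l))"
    by (intro mult_left_mono) auto
  moreover have "2 * penalty \<kappa> \<sigma> n L D m + 2 / real n * (16 * \<sigma>\<^sup>2 * (1 + S))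
      = \<sigma>\<^sup>2 / real n * (32 * (D m * (9 * 2 ^ 15 * \<kappa> * l + L m)) + 32 * (1 + S))"
    by (simp add: penalty_def l_def algebra_simps add_divide_distrib)
  ultimately show ?thesis by (simp add: l_def mult_ac)
qed

text \<open>Independence of the generated sigma-algebras is the product formula on preimages of
  rectangles, and rectangles determine the product of two sigma-finite measures.\<close>

lemma (in prob_space) distr_pair_indep_set:
  assumes X[measurable]: "X \<in> measurable M A" and Y[measurable]: "Y \<in> measurable M B"
    and indep: "indep_set (sets (vimage_algebra (space M) X A)) (sets (vimage_algebra (space M) Y B))"
  shows "distr M A X \<Otimes>\<^sub>M distr M B Y = distr M (A \<Otimes>\<^sub>M B) (\<lambda>\<omega>. (X \<omega>, Y \<omega>))"
proof (rule pair_measure_eqI)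
  show "sigma_finite_measure (distr M A X)" "sigma_finite_measure (distr M B Y)"
    using prob_space_distr[OF X] prob_space_distr[OF Y] prob_space_imp_sigma_finite by auto
next
  fix a b assume "a \<in> sets (distr M A X)" "b \<in> sets (distr M B Y)"
  then have [measurable]: "a \<in> sets A" "b \<in> sets B" by auto
  have "X -` a \<inter> space M \<in> sets (vimage_algebra (space M) X A)"
    "Y -` b \<inter> space M \<in> sets (vimage_algebra (space M) Y B)"
    by (auto intro: in_vimage_algebra)
  then have "prob ((X -` a \<inter> space M) \<inter> (Y -` b \<inter> space M))
      = prob (X -` a \<inter> space M) * prob (Y -` b \<inter> space M)"
    by (rule indep_setD[OF indep])
  moreover have "(\<lambda>\<omega>. (X \<omega>, Y \<omega>)) -` (a \<times> b) \<inter> space M = (X -` a \<inter> space M) \<inter> (Y -` b \<inter> space M)"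
    by auto
  ultimately show "emeasure (distr M A X) a * emeasure (distr M B Y) b
      = emeasure (distr M (A \<Otimes>\<^sub>M B) (\<lambda>\<omega>. (X \<omega>, Y \<omega>))) (a \<times> b)"
    by (simp add: emeasure_distr emeasure_eq_measure ennreal_mult)
qed simp

text \<open>The data are the image under \<open>T\<close> of the pair of design and noise, whose law
  is a product. Integrals over the data can thus be iterated, with the design frozen while the noise
  is averaged.\<close>

lemma (in prob_space) data_distr:
  assumes X: "\<And>i. i < n \<Longrightarrow> X i \<in> measurable M \<nu>" and \<epsilon>: "\<And>i. i < n \<Longrightarrow> \<epsilon> i \<in> borel_measurable M"
    and indep: "indep_set
          (sets (vimage_algebra (space M) (sample n X) (\<Pi>\<^sub>M i\<in>{..<n}. \<nu>)))
          (sets (vimage_algebra (space M) (sample n \<epsilon>) (\<Pi>\<^sub>M i\<in>{..<n}. borel)))"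
    and Y: "\<And>i \<omega>. i < n \<Longrightarrow> \<omega> \<in> space M \<Longrightarrow> Y i \<omega> = f0 (X i \<omega>) + \<epsilon> i \<omega>"
    and f0: "f0 \<in> borel_measurable \<nu>"
  defines "T \<equiv> \<lambda>(x, e). (x, \<lambda>i\<in>{..<n}. f0 (x i) + e i)"
  shows "T \<in> measurable (data_space n \<nu>) (data_space n \<nu>)"
    and "distr M (data_space n \<nu>) (data n X Y)
      = distr (distr M (\<Pi>\<^sub>M i\<in>{..<n}. \<nu>) (sample n X) \<Otimes>\<^sub>M distr M (\<Pi>\<^sub>M i\<in>{..<n}. borel) (sample n \<epsilon>))
          (data_space n \<nu>) T"
    and "data n X Y \<in> measurable M (data_space n \<nu>)"
proof -
  let ?A = "\<Pi>\<^sub>M i\<in>{..<n}. \<nu>" and ?B = "\<Pi>\<^sub>M i\<in>{..<n}. (borel :: real measure)"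
  have mX[measurable]: "sample n X \<in> measurable M ?A"
    unfolding sample_def[abs_def] by (intro measurable_restrict) (simp add: X)
  have m\<epsilon>[measurable]: "sample n \<epsilon> \<in> measurable M ?B"
    unfolding sample_def[abs_def] by (intro measurable_restrict) (simp add: \<epsilon>)
  note f0[measurable]
  show T: "T \<in> measurable (data_space n \<nu>) (data_space n \<nu>)"
    unfolding T_def data_space_def by measurable
  have data: "data n X Y \<omega> = T (sample n X \<omega>, sample n \<epsilon> \<omega>)" if "\<omega> \<in> space M" for \<omega>
    using Y that by (auto simp: data_def T_def sample_def restrict_def)
  have "(\<lambda>\<omega>. (sample n X \<omega>, sample n \<epsilon> \<omega>)) \<in> measurable M (data_space n \<nu>)"
    unfolding data_space_def by measurable
  moreover from measurable_compose[OF this T] show "data n X Y \<in> measurable M (data_space n \<nu>)"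
    by (simp add: data cong: measurable_cong)
  moreover have joint: "distr M ?A (sample n X) \<Otimes>\<^sub>M distr M ?B (sample n \<epsilon>)
      = distr M (data_space n \<nu>) (\<lambda>\<omega>. (sample n X \<omega>, sample n \<epsilon> \<omega>))"
    unfolding data_space_def by (rule distr_pair_indep_set[OF mX m\<epsilon> indep])
  ultimately show "distr M (data_space n \<nu>) (data n X Y)
      = distr (distr M ?A (sample n X) \<Otimes>\<^sub>M distr M ?B (sample n \<epsilon>)) (data_space n \<nu>) T"
    unfolding joint using T by (subst distr_distr) (auto intro!: distr_cong simp: data)
qed

section \<open>Risk at a fixed design\<close>

text \<open>Integrates the basic inequality over the law of the noise, with the noise term replaced
  by its uniform bound \<open>R\<close>.\<close>

lemma (in prob_space) fixed_design_risk_bound: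
  fixes \<epsilon> :: "nat \<Rightarrow> 'a \<Rightarrow> real" and P :: "nat \<Rightarrow> ('b \<Rightarrow> real) set" and L D :: "nat \<Rightarrow> real"
    and x :: "nat \<Rightarrow> 'b" and f0 :: "'b \<Rightarrow> real"
  assumes \<kappa>: "entropy_constant \<kappa>" and n: "n \<ge> 7" and \<sigma>: "\<sigma> > 0"
    and indep: "indep_vars (\<lambda>_. borel) \<epsilon> {..<n}"
    and normal: "\<And>i. i < n \<Longrightarrow> distributed M lborel (\<epsilon> i) (\<lambda>z. ennreal (normal_density 0 \<sigma> z))"
    and pdim: "\<And>m. real (pdim n (traces n x (P m))) \<le> D m"
    and D: "\<And>m. D m \<ge> 1" and L: "\<And>m. L m \<ge> 1" and S: "(\<lambda>m. exp (- L m * D m)) sums S"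
    and g: "g \<in> P m"
  defines "d \<equiv> \<lambda>e. (x, \<lambda>i\<in>{..<n}. f0 (x i) + e i)"
  assumes minimal: "AE e in distr M (\<Pi>\<^sub>M i\<in>{..<n}. borel) (sample n \<epsilon>).
      (\<forall>m. is_arg_min (emp_risk n (d e)) (\<lambda>f. f \<in> P m) (fhat m (d e))) \<and>
      is_arg_min (\<lambda>m. contrast n (d e) (fhat m (d e)) + penalty \<kappa> \<sigma> n L D m) (\<lambda>_. True) (mhat (d e))"
  shows "(\<integral>\<^sup>+e. ennreal (emp_sq_dist n x (fhat (mhat (d e)) (d e)) f0) \<partial>distr M (\<Pi>\<^sub>M i\<in>{..<n}. borel) (sample n \<epsilon>))
    \<le> 3 * ennreal (emp_sq_dist n x f0 g)
      + ennreal (2 * penalty \<kappa> \<sigma> n L D m + 2 / real n * (16 * \<sigma>\<^sup>2 * (1 + S)))"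
proof -
  let ?B = "\<Pi>\<^sub>M i\<in>{..<n}. (borel :: real measure)"
  let ?pen = "penalty \<kappa> \<sigma> n L D"
  \<comment> \<open>The nets are centred at the trace of the comparison function \<open>g\<close>,
    so \<open>R\<close> depends on \<open>x\<close> and \<open>g\<close> but on no choice made from
    the data.\<close>
  obtain R where R[measurable]: "R \<in> borel_measurable ?B"
    and R_int: "(\<integral>\<^sup>+\<omega>. R (sample n \<epsilon> \<omega>) \<partial>M) \<le> ennreal (16 * \<sigma>\<^sup>2 * (1 + S))"
    and R: "\<forall>e m. \<forall>v\<in>traces n x (P m). ennreal (2 * (\<Sum>i<n. e i * (v i - g (x i))) - (\<Sum>i<n. (v i - g (x i))\<^sup>2) / 4
        - real n * ?pen m) \<le> R e"
    by (rule fixed_design_noise_bound[OF \<kappa> n \<sigma> indep normal pdim D L S, of "\<lambda>i. g (x i)"]) assumption+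
  have \<epsilon>_meas: "\<epsilon> i \<in> borel_measurable M" if "i \<in> {..<n}" for i
    using indep that by (auto simp: indep_vars_def)
  have [measurable]: "sample n \<epsilon> \<in> measurable M ?B"
    unfolding sample_def[abs_def] by (intro measurable_restrict \<epsilon>_meas)
  interpret N: prob_space "distr M ?B (sample n \<epsilon>)" by (rule prob_space_distr) simp
  have pen0: "?pen m \<ge> 0"
    using D[of m] L[of m] \<kappa> n by (simp add: penalty_def entropy_constant_def)
  have S0: "S \<ge> 0" by (rule sums_le[OF _ sums_zero S]) simp
  have emp0: "emp_sq_dist n x f h \<ge> 0" for f h :: "'b \<Rightarrow> real"
    by (simp add: emp_sq_dist_def sum_nonneg)
  have loss: "ennreal (emp_sq_dist n x (fhat (mhat (d e)) (d e)) f0)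
      \<le> ennreal (3 * emp_sq_dist n x f0 g + 2 * ?pen m) + ennreal (2 / real n) * R e"
    if opt: "(\<forall>m. is_arg_min (emp_risk n (d e)) (\<lambda>f. f \<in> P m) (fhat m (d e))) \<and>
      is_arg_min (\<lambda>m. contrast n (d e) (fhat m (d e)) + ?pen m) (\<lambda>_. True) (mhat (d e))" for e
  proof -
    define k where "k = mhat (d e)"
    define f where "f = (\<lambda>m. fhat m (d e))"
    define r where "r = 2 * (\<Sum>i<n. e i * (f k (x i) - g (x i))) - (\<Sum>i<n. (f k (x i) - g (x i))\<^sup>2) / 4
        - real n * ?pen k"
    \<comment> \<open>Membership of the estimator in its own model is all that the uniform bound
      asks for; how \<open>k\<close> depends on \<open>e\<close> is irrelevant.\<close>
    have "f k \<in> P k" using opt by (auto simp: f_def is_arg_min_def)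
    then have "(\<lambda>i\<in>{..<n}. f k (x i)) \<in> traces n x (P k)" by (auto simp: traces_def)
    with R have "ennreal (2 * (\<Sum>i<n. e i * ((\<lambda>i\<in>{..<n}. f k (x i)) i - g (x i)))
        - (\<Sum>i<n. ((\<lambda>i\<in>{..<n}. f k (x i)) i - g (x i))\<^sup>2) / 4 - real n * ?pen k) \<le> R e" by blast
    then have r: "ennreal r \<le> R e" by (simp add: r_def)
    have "emp_sq_dist n x (f k) f0 \<le> 3 * emp_sq_dist n x g f0 + 2 * ?pen m + 2 / real n * r"
      unfolding r_def
      by (rule penalized_least_squares_basic_inequality[where y = "\<lambda>i\<in>{..<n}. f0 (x i) + e i" and P = P])
        (use n g opt in \<open>auto simp: f_def k_def d_def\<close>)
    moreover have "emp_sq_dist n x g f0 = emp_sq_dist n x f0 g"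
      by (simp add: emp_sq_dist_def power2_commute)
    ultimately have "emp_sq_dist n x (f k) f0 \<le> 3 * emp_sq_dist n x f0 g + 2 * ?pen m + 2 / real n * r"
      by simp
    then have "ennreal (emp_sq_dist n x (f k) f0)
        \<le> ennreal (3 * emp_sq_dist n x f0 g + 2 * ?pen m) + ennreal (2 / real n * r)"
      by (rule order_trans[OF ennreal_leI ennreal_add_le])
    also have "ennreal (2 / real n * r) = ennreal (2 / real n) * ennreal r"
      by (rule ennreal_mult') simp
    also have "\<dots> \<le> ennreal (2 / real n) * R e" using r by (rule mult_left_mono) simp
    finally show ?thesis by (simp add: f_def k_def add_left_mono)
  qed
  have "(\<integral>\<^sup>+e. ennreal (emp_sq_dist n x (fhat (mhat (d e)) (d e)) f0) \<partial>distr M ?B (sample n \<epsilon>))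
      \<le> (\<integral>\<^sup>+e. ennreal (3 * emp_sq_dist n x f0 g + 2 * ?pen m) + ennreal (2 / real n) * R e
          \<partial>distr M ?B (sample n \<epsilon>))"
    using minimal by (intro nn_integral_mono_AE) (elim eventually_mono, rule loss)
  also have "\<dots> = ennreal (3 * emp_sq_dist n x f0 g + 2 * ?pen m)
      + ennreal (2 / real n) * (\<integral>\<^sup>+e. R e \<partial>distr M ?B (sample n \<epsilon>))"
    by (subst nn_integral_add) (auto simp: nn_integral_cmult N.emeasure_space_1[simplified])
  also have "(\<integral>\<^sup>+e. R e \<partial>distr M ?B (sample n \<epsilon>)) = (\<integral>\<^sup>+\<omega>. R (sample n \<epsilon> \<omega>) \<partial>M)"
    by (rule nn_integral_distr) auto
  also have "ennreal (3 * emp_sq_dist n x f0 g + 2 * ?pen m) + ennreal (2 / real n) * \<dots>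
      \<le> ennreal (3 * emp_sq_dist n x f0 g + 2 * ?pen m) + ennreal (2 / real n) * ennreal (16 * \<sigma>\<^sup>2 * (1 + S))"
    using R_int by (intro add_left_mono mult_left_mono) auto
  also have "\<dots> = 3 * ennreal (emp_sq_dist n x f0 g)
      + ennreal (2 * ?pen m + 2 / real n * (16 * \<sigma>\<^sup>2 * (1 + S)))"
    using emp0 pen0 S0 by (simp add: ennreal_plus ennreal_mult add.assoc del: times_divide_eq_left)
  finally show ?thesis .
qed

section \<open>Averaging over the design and passing to the infima\<close>

theorem theorem4p7:
  fixes M :: "'w measure"
    and \<Omega> :: "(real ^ 'd) set"
    and \<nu> :: "(real ^ 'd) measure"
    and n :: nat
    and X :: "nat \<Rightarrow> 'w \<Rightarrow> real ^ 'd"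
    and \<epsilon> Y :: "nat \<Rightarrow> 'w \<Rightarrow> real"
    and f0 :: "real ^ 'd \<Rightarrow> real"
    and P :: "nat \<Rightarrow> (real ^ 'd \<Rightarrow> real) set"
    and D L :: "nat \<Rightarrow> real"
    and \<sigma> \<kappa> S :: real
    and fhat :: "nat \<Rightarrow> (nat \<Rightarrow> real ^ 'd) \<times> (nat \<Rightarrow> real) \<Rightarrow> real ^ 'd \<Rightarrow> real"
    and mhat :: "(nat \<Rightarrow> real ^ 'd) \<times> (nat \<Rightarrow> real) \<Rightarrow> nat"
  assumes "prob_space M"
    and "prob_space \<nu>" and "sets \<nu> = sets (restrict_space borel \<Omega>)"
    and "n \<ge> 7"
    and X_indep: "prob_space.indep_vars M (\<lambda>_. \<nu>) X {..<n}"
    and X_distr: "\<And>i. i < n \<Longrightarrow> distr M \<nu> (X i) = \<nu>"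
    and eps_indep: "prob_space.indep_vars M (\<lambda>_. borel) \<epsilon> {..<n}"
    and "\<sigma> > 0"
    and eps_normal: "\<And>i. i < n \<Longrightarrow> distributed M lborel (\<epsilon> i) (\<lambda>z. ennreal (normal_density 0 \<sigma> z))"
    and X_eps_indep: "prob_space.indep_set M
          (sets (vimage_algebra (space M) (sample n X) (\<Pi>\<^sub>M i\<in>{..<n}. \<nu>)))
          (sets (vimage_algebra (space M) (sample n \<epsilon>) (\<Pi>\<^sub>M i\<in>{..<n}. borel)))"
    and Y: "\<And>i \<omega>. i < n \<Longrightarrow> \<omega> \<in> space M \<Longrightarrow> Y i \<omega> = f0 (X i \<omega>) + \<epsilon> i \<omega>"
    and "f0 \<in> square_integrable \<nu>"
    and "\<And>m. P m \<subseteq> square_integrable \<nu>"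
    and "entropy_constant \<kappa>"
    and "\<And>m. D m \<ge> 1"
    and pdim: "\<And>m. AE \<omega> in M. real (pdim n (traces n (sample n X \<omega>) (P m))) \<le> D m"
    and "\<And>m. L m \<ge> 1"
    and "(\<lambda>m. exp (- L m * D m)) sums S"
    and fhat: "\<And>m. AE d in distr M (data_space n \<nu>) (data n X Y).
                 is_arg_min (emp_risk n d) (\<lambda>f. f \<in> P m) (fhat m d)"
    and mhat: "AE d in distr M (data_space n \<nu>) (data n X Y).
                 is_arg_min (\<lambda>m. contrast n d (fhat m d) + penalty \<kappa> \<sigma> n L D m) (\<lambda>_. True) (mhat d)"
    and loss_measurable: "(\<lambda>d. emp_sq_dist n (fst d) (fhat (mhat d) d) f0)
                            \<in> borel_measurable (data_space n \<nu>)"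
  shows "(\<integral>\<^sup>+\<omega>. ennreal (emp_sq_dist n (sample n X \<omega>)
             (fhat (mhat (data n X Y \<omega>)) (data n X Y \<omega>)) f0) \<partial>M)
         \<le> ennreal (INF m. 3 * (INF g\<in>P m. sq_dist \<nu> f0 g)
                     + risk_constant \<kappa> S * (\<sigma>\<^sup>2 * L m * D m * ln (real n) / real n))"
proof -
  interpret prob_space M by fact
  let ?A = "\<Pi>\<^sub>M i\<in>{..<n}. \<nu>" and ?B = "\<Pi>\<^sub>M i\<in>{..<n}. (borel :: real measure)"
  let ?Q = "distr M ?A (sample n X)" and ?R = "distr M ?B (sample n \<epsilon>)"
  have n: "n > 0" using \<open>n \<ge> 7\<close> by simp
  have mX: "X i \<in> measurable M \<nu>" if "i < n" for i
    using X_indep that by (auto simp: indep_vars_def)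
  have m\<epsilon>: "\<epsilon> i \<in> borel_measurable M" if "i < n" for i
    using eps_indep that by (auto simp: indep_vars_def)
  have f0: "f0 \<in> borel_measurable \<nu>"
    using \<open>f0 \<in> square_integrable \<nu>\<close> by (simp add: square_integrable_def)
  have \<kappa>: "\<kappa> \<ge> 1" using \<open>entropy_constant \<kappa>\<close> by (simp add: entropy_constant_def)
  have S0: "S \<ge> 0"
    by (rule sums_le[OF _ sums_zero \<open>(\<lambda>m. exp (- L m * D m)) sums S\<close>]) simp
  have mX'[measurable]: "sample n X \<in> measurable M ?A"
    unfolding sample_def[abs_def] by (intro measurable_restrict) (simp add: mX)
  have m\<epsilon>'[measurable]: "sample n \<epsilon> \<in> measurable M ?B"
    unfolding sample_def[abs_def] by (intro measurable_restrict) (simp add: m\<epsilon>)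
  interpret Q: prob_space ?Q by (rule prob_space_distr) simp
  interpret R: prob_space ?R by (rule prob_space_distr) simp
  interpret QR: pair_prob_space ?Q ?R ..
  define T where "T = (\<lambda>(x, e). (x, \<lambda>i\<in>{..<n}. f0 (x i) + e i :: real))"
  have data: "T \<in> measurable (data_space n \<nu>) (data_space n \<nu>)"
    "distr M (data_space n \<nu>) (data n X Y) = distr (?Q \<Otimes>\<^sub>M ?R) (data_space n \<nu>) T"
    "data n X Y \<in> measurable M (data_space n \<nu>)"
    unfolding T_def
    by (rule data_distr[where n = n and X = X and \<nu> = \<nu> and \<epsilon> = \<epsilon> and Y = Y and ?f0.0 = f0];
        fact mX m\<epsilon> X_eps_indep Y f0)+
  have sets_QR: "sets (?Q \<Otimes>\<^sub>M ?R) = sets (data_space n \<nu>)"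
    unfolding data_space_def by (intro sets_pair_measure_cong) auto
  have T: "T \<in> measurable (?Q \<Otimes>\<^sub>M ?R) (data_space n \<nu>)"
    using data(1) measurable_cong_sets[OF sets_QR refl] by blast
  define loss where "loss d = ennreal (emp_sq_dist n (fst d) (fhat (mhat d) d) f0)" for d
  define opt where "opt d \<longleftrightarrow> (\<forall>m. is_arg_min (emp_risk n d) (\<lambda>f. f \<in> P m) (fhat m d)) \<and>
      is_arg_min (\<lambda>m. contrast n d (fhat m d) + penalty \<kappa> \<sigma> n L D m) (\<lambda>_. True) (mhat d)" for d
  \<comment> \<open>By independence of design and noise this is the conditional risk given the
    design \<open>x\<close>.\<close>
  define H where "H x = (\<integral>\<^sup>+e. loss (T (x, e)) \<partial>?R)" for x
  have loss_meas: "loss \<in> borel_measurable (data_space n \<nu>)"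
    unfolding loss_def[abs_def] using loss_measurable by measurable
  then have loss_T: "(\<lambda>p. loss (T p)) \<in> borel_measurable (?Q \<Otimes>\<^sub>M ?R)"
    using T by measurable
  then have H_meas: "H \<in> borel_measurable ?A"
    unfolding H_def[abs_def] using R.borel_measurable_nn_integral_fst by fastforce
  \<comment> \<open>Countably many almost sure statements combine into one; Fubini then gives it for
    almost every noise vector at almost every design.\<close>
  have "AE d in distr M (data_space n \<nu>) (data n X Y). opt d"
    unfolding opt_def using fhat mhat by (simp add: AE_all_countable)
  then have "AE p in ?Q \<Otimes>\<^sub>M ?R. opt (T p)"
    unfolding data(2) by (rule AE_distrD[OF T])
  then have "AE x in ?Q. AE e in ?R. opt (T (x, e))"
    by (rule QR.AE_pair)
  then have ae_opt: "AE \<omega> in M. AE e in ?R. opt (T (sample n X \<omega>, e))"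
    by (rule AE_distrD[OF mX'])
  \<comment> \<open>A minimizer belongs to its model, so the models are nonempty almost surely; as
    this does not involve \<open>\<omega>\<close>, it holds outright in a probability space.\<close>
  have "AE \<omega> in M. \<forall>m. P m \<noteq> {}"
    using AE_distrD[OF data(3) \<open>AE d in distr M (data_space n \<nu>) (data n X Y). opt d\<close>]
    by (elim eventually_mono) (auto simp: opt_def is_arg_min_def)
  then have P_ne: "P m \<noteq> {}" for m by simp
  \<comment> \<open>The set of designs satisfying the bound on the pseudo-dimension need not be measurable, so this
    holds almost everywhere in \<open>M\<close> but not necessarily under the law of the design.\<close>
  have pdim_all: "AE \<omega> in M. \<forall>m. real (pdim n (traces n (sample n X \<omega>) (P m))) \<le> D m"
    using pdim by (simp add: AE_all_countable)
  define I where "I = (\<integral>\<^sup>+\<omega>. ennreal (emp_sq_dist n (sample n X \<omega>)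
             (fhat (mhat (data n X Y \<omega>)) (data n X Y \<omega>)) f0) \<partial>M)"
  have "I = (\<integral>\<^sup>+\<omega>. loss (data n X Y \<omega>) \<partial>M)"
    by (simp add: I_def loss_def data_def)
  also have "\<dots> = (\<integral>\<^sup>+d. loss d \<partial>distr M (data_space n \<nu>) (data n X Y))"
    using data(3) loss_meas by (simp add: nn_integral_distr)
  also have "\<dots> = (\<integral>\<^sup>+p. loss (T p) \<partial>(?Q \<Otimes>\<^sub>M ?R))"
    unfolding data(2) using loss_meas by (simp add: nn_integral_distr[OF T])
  also have "\<dots> = (\<integral>\<^sup>+x. H x \<partial>?Q)"
    unfolding H_def using R.nn_integral_fst[OF loss_T] by simp
  \<comment> \<open>Integration returns to \<open>M\<close>, where the bound on the pseudo-dimension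
    is available.\<close>
  also have "\<dots> = (\<integral>\<^sup>+\<omega>. H (sample n X \<omega>) \<partial>M)"
    using H_meas by (simp add: nn_integral_distr)
  finally have I: "I = (\<integral>\<^sup>+\<omega>. H (sample n X \<omega>) \<partial>M)" .
  have c0: "0 \<le> risk_constant \<kappa> S * (\<sigma>\<^sup>2 * L m * D m * ln (real n) / real n)" for m
  proof -
    have "0 \<le> L m" "0 \<le> D m" using order_trans[OF zero_le_one] \<open>\<And>m. D m \<ge> 1\<close> \<open>\<And>m. L m \<ge> 1\<close> by auto
    then show ?thesis using n \<kappa> S0 by (simp add: risk_constant_def)
  qed
  have bound: "I \<le> ennreal (3 * sq_dist \<nu> f0 g + risk_constant \<kappa> S * (\<sigma>\<^sup>2 * L m * D m * ln (real n) / real n))"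
    if g: "g \<in> P m" for m g
  proof -
    let ?c = "2 * penalty \<kappa> \<sigma> n L D m + 2 / real n * (16 * \<sigma>\<^sup>2 * (1 + S))"
    have g2: "g \<in> square_integrable \<nu>" using g \<open>\<And>m. P m \<subseteq> square_integrable \<nu>\<close> by blast
    then have [measurable]: "g \<in> borel_measurable \<nu>" by (simp add: square_integrable_def)
    note f0[measurable]
    have "(\<lambda>x. emp_sq_dist n x f0 g) \<in> borel_measurable ?A"
      unfolding emp_sq_dist_def by measurable
    then have emp_meas[measurable]: "(\<lambda>\<omega>. ennreal (emp_sq_dist n (sample n X \<omega>) f0 g)) \<in> borel_measurable M"
      by measurable
    \<comment> \<open>The design is frozen at \<open>sample n X \<omega>\<close>, while the integral
      in \<open>H\<close> still runs over the law of the noise.\<close>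
    have "AE \<omega> in M. H (sample n X \<omega>) \<le> 3 * ennreal (emp_sq_dist n (sample n X \<omega>) f0 g) + ennreal ?c"
      using ae_opt pdim_all
    proof eventually_elim
      case (elim \<omega>)
      show ?case
        unfolding H_def loss_def T_def prod.case fst_conv
        by (rule fixed_design_risk_bound[where P = P and L = L and D = D and fhat = fhat and mhat = mhat])
          (use \<open>entropy_constant \<kappa>\<close> \<open>n \<ge> 7\<close> \<open>\<sigma> > 0\<close> eps_indep eps_normal \<open>\<And>m. D m \<ge> 1\<close> \<open>\<And>m. L m \<ge> 1\<close>
            \<open>(\<lambda>m. exp (- L m * D m)) sums S\<close> g elim in \<open>auto simp: opt_def T_def\<close>)
    qed
    then have "I \<le> (\<integral>\<^sup>+\<omega>. 3 * ennreal (emp_sq_dist n (sample n X \<omega>) f0 g) + ennreal ?c \<partial>M)"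
      unfolding I by (rule nn_integral_mono_AE)
    also have "\<dots> = 3 * ennreal (sq_dist \<nu> f0 g) + ennreal ?c"
      using nn_integral_emp_sq_dist[OF n mX X_distr \<open>f0 \<in> square_integrable \<nu>\<close> g2]
      by (simp add: nn_integral_add nn_integral_cmult emeasure_space_1)
    also have "\<dots> = ennreal (3 * sq_dist \<nu> f0 g) + ennreal ?c"
      by (simp add: ennreal_mult sq_dist_def)
    also have "\<dots> \<le> ennreal (3 * sq_dist \<nu> f0 g)
        + ennreal (risk_constant \<kappa> S * (\<sigma>\<^sup>2 * L m * D m * ln (real n) / real n))"
      using risk_bound_le_risk_constant[of n \<kappa> D m L S \<sigma>] \<open>n \<ge> 7\<close> \<kappa> S0 \<open>\<And>m. D m \<ge> 1\<close> \<open>\<And>m. L m \<ge> 1\<close>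
      by (intro add_left_mono ennreal_leI) auto
    also have "\<dots> = ennreal (3 * sq_dist \<nu> f0 g + risk_constant \<kappa> S * (\<sigma>\<^sup>2 * L m * D m * ln (real n) / real n))"
      by (rule ennreal_plus[symmetric]) (simp_all only: c0, simp add: sq_dist_def)
    finally show ?thesis .
  qed
  \<comment> \<open>One instance of the bound makes \<open>I\<close> finite, so the infima can be
    handled over the reals.\<close>
  obtain g0 where "g0 \<in> P 0" using P_ne by blast
  from bound[OF this] have "I < top" by (rule le_less_trans) simp
  then obtain r where r: "r \<ge> 0" "I = ennreal r" by (cases I) auto
  have "r \<le> (INF m. 3 * (INF g\<in>P m. sq_dist \<nu> f0 g)
      + risk_constant \<kappa> S * (\<sigma>\<^sup>2 * L m * D m * ln (real n) / real n))"
  proof (rule cINF_greatest)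
    fix m
    let ?c = "risk_constant \<kappa> S * (\<sigma>\<^sup>2 * L m * D m * ln (real n) / real n)"
    \<comment> \<open>Solving the bound for the distance exhibits a lower bound of the inner
      infimum, so no constant has to be moved through it.\<close>
    have "(r - ?c) / 3 \<le> (INF g\<in>P m. sq_dist \<nu> f0 g)"
    proof (rule cINF_greatest[OF P_ne])
      fix g assume "g \<in> P m"
      moreover have "0 \<le> sq_dist \<nu> f0 g" by (simp add: sq_dist_def)
      ultimately have "r \<le> 3 * sq_dist \<nu> f0 g + ?c"
        using bound[of g m] c0[of m] r by (simp add: ennreal_le_iff del: ennreal_plus)
      then show "(r - ?c) / 3 \<le> sq_dist \<nu> f0 g" by simp
    qed
    then show "r \<le> 3 * (INF g\<in>P m. sq_dist \<nu> f0 g) + ?c" by simp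
  qed simp
  then show ?thesis using r(2) by (simp add: ennreal_leI flip: I_def)
qed

end
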